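(* Suppose $\prec$ is a binary relation on $\mathbb{N}^n$ definable in $(\mathbb{N},+)$ such that $(\mathbb{N}^n,\prec)$ is a linear order of order type $\mathbb{N}$ (that of $(\mathbb{N},<)$). Then the order isomorphism between $(\mathbb{N}^n,\prec)$ and $(\mathbb{N},<)$ is a piecewise polynomial function of degree $\le n$.
   Context: Definable means first-order definable in $(\mathbb{N},+)$ without parameters. For $\bar c,\bar p_1,\dots,\bar p_k\in\mathbb{Z}^n$ with $\bar p_1,\dots,\bar p_k$ linearly independent, $\{\bar c+\sum_i k_i\bar p_i\mid k_i\in\mathbb{N}\}$ is a fundamental lattice. A function $f:\mathbb{N}^n\to\mathbb{N}$ is piecewise polynomial of degree $\le d$ if $\mathbb{N}^n$ can be decomposed into finitely many disjoint fundamental lattices $C_1,\dots,C_k$ such that the restriction of $f$ to each $C_j$ is a polynomial with rational coefficients of degree $\le d$. *)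

theory Defs
  imports
    "Jordan_Normal_Form.VS_Connect"
    "HOL-Library.Disjoint_Sets"
begin

text \<open>
  First-order formulas with equality over the signature consisting of one binary function
  symbol, with de Bruijn indices. There are no constant symbols, so that
  definitions are parameter-free.
\<close>

datatype tm = Var nat | Plus tm tm

datatype fm = Eq tm tm | Neg fm | Conj fm fm | Exi fm

fun tm_val :: "(nat \<Rightarrow> nat) \<Rightarrow> tm \<Rightarrow> nat" where
  "tm_val e (Var i) = e i"
| "tm_val e (Plus s t) = tm_val e s + tm_val e t"

fun sat :: "(nat \<Rightarrow> nat) \<Rightarrow> fm \<Rightarrow> bool" where
  "sat e (Eq s t) \<longleftrightarrow> tm_val e s = tm_val e t"
| "sat e (Neg \<phi>) \<longleftrightarrow> \<not> sat e \<phi>"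
| "sat e (Conj \<phi> \<psi>) \<longleftrightarrow> sat e \<phi> \<and> sat e \<psi>"
| "sat e (Exi \<phi>) \<longleftrightarrow> (\<exists>a. sat (case_nat a e) \<phi>)"

fun tm_vars :: "tm \<Rightarrow> nat set" where
  "tm_vars (Var i) = {i}"
| "tm_vars (Plus s t) = tm_vars s \<union> tm_vars t"

fun free_vars :: "fm \<Rightarrow> nat set" where
  "free_vars (Eq s t) = tm_vars s \<union> tm_vars t"
| "free_vars (Neg \<phi>) = free_vars \<phi>"
| "free_vars (Conj \<phi> \<psi>) = free_vars \<phi> \<union> free_vars \<psi>"
| "free_vars (Exi \<phi>) = {i. Suc i \<in> free_vars \<phi>}"

text \<open>
  The bound on the free variables is essential: the value of \<open>x $ i\<close> for
  \<open>i \<ge> dim_vec x\<close> is unspecified and must not act as a parameter.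
\<close>

definition definable :: "nat \<Rightarrow> nat vec set \<Rightarrow> bool" where
  "definable m S \<longleftrightarrow> S \<subseteq> carrier_vec m \<and>
     (\<exists>\<phi>. free_vars \<phi> \<subseteq> {..<m} \<and> (\<forall>x\<in>carrier_vec m. x \<in> S \<longleftrightarrow> sat (\<lambda>i. x $ i) \<phi>))"

definition definable_rel :: "nat \<Rightarrow> nat vec rel \<Rightarrow> bool" where
  "definable_rel n R \<longleftrightarrow> R \<subseteq> carrier_vec n \<times> carrier_vec n \<and>
     definable (n + n) ((\<lambda>(x, y). x @\<^sub>v y) ` R)"

text \<open>
  The periods form a set rather than a family; this loses nothing, since the members of a
  linearly independent family are distinct. Independence is that of the
  \<open>\<int>\<close>-module of integer vectors of dimension \<open>n\<close>.
\<close>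

definition fundamental_lattice :: "nat \<Rightarrow> int vec set \<Rightarrow> bool" where
  "fundamental_lattice n C \<longleftrightarrow>
     (\<exists>c P. c \<in> carrier_vec n \<and> finite P \<and> P \<subseteq> carrier_vec n \<and>
        LinearCombinations.module.lin_indpt class_ring (module_vec TYPE(int) n) P \<and>
        C = {c + finsum_vec TYPE(int) n (\<lambda>p. int (k p) \<cdot>\<^sub>v p) P | k :: int vec \<Rightarrow> nat. True})"

definition polynomial_on :: "nat \<Rightarrow> nat \<Rightarrow> nat vec set \<Rightarrow> (nat vec \<Rightarrow> nat) \<Rightarrow> bool" where
  "polynomial_on n d D f \<longleftrightarrow>
     (\<exists>a :: nat vec \<Rightarrow> rat. \<forall>x\<in>D.
        of_nat (f x) = (\<Sum>\<alpha> | \<alpha> \<in> carrier_vec n \<and> (\<Sum>i<n. \<alpha> $ i) \<le> d.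
                          a \<alpha> * (\<Prod>i<n. of_nat (x $ i) ^ (\<alpha> $ i))))"

definition piecewise_polynomial :: "nat \<Rightarrow> nat \<Rightarrow> (nat vec \<Rightarrow> nat) \<Rightarrow> bool" where
  "piecewise_polynomial n d f \<longleftrightarrow>
     (\<exists>\<C>. finite \<C> \<and> partition_on (map_vec int ` carrier_vec n) \<C> \<and>
        (\<forall>C\<in>\<C>. fundamental_lattice n C \<and>
           polynomial_on n d {x \<in> carrier_vec n. map_vec int x \<in> C} f))"

definition order_iso_nat :: "nat \<Rightarrow> nat vec rel \<Rightarrow> (nat vec \<Rightarrow> nat) \<Rightarrow> bool" where
  "order_iso_nat n R f \<longleftrightarrow> bij_betw f (carrier_vec n) UNIV \<and>
     (\<forall>x\<in>carrier_vec n. \<forall>y\<in>carrier_vec n. (x, y) \<in> R \<longleftrightarrow> f x < f y)"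

text \<open>
  The finiteness below guards the sum in \<open>polynomial_on\<close>, which would silently be zero over an
  infinite set of exponents.
\<close>

lemma finite_exponents:
  "finite {\<alpha> :: nat vec. \<alpha> \<in> carrier_vec n \<and> (\<Sum>i<n. \<alpha> $ i) \<le> d}"
proof (rule finite_subset)
  show "{\<alpha> :: nat vec. \<alpha> \<in> carrier_vec n \<and> (\<Sum>i<n. \<alpha> $ i) \<le> d}
        \<subseteq> vec_of_list ` {xs. set xs \<subseteq> {..d} \<and> length xs = n}"
  proof
    fix \<alpha> :: "nat vec" assume "\<alpha> \<in> {\<alpha>. \<alpha> \<in> carrier_vec n \<and> (\<Sum>i<n. \<alpha> $ i) \<le> d}"
    then have \<alpha>: "\<alpha> \<in> carrier_vec n" and s: "(\<Sum>i<n. \<alpha> $ i) \<le> d" by auto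
    have "\<alpha> $ i \<le> d" if "i < n" for i
      using member_le_sum[of i "{..<n}" "\<lambda>i. \<alpha> $ i"] that s by auto
    then have "set (list_of_vec \<alpha>) \<subseteq> {..d}"
      using \<alpha> by (auto simp: in_set_conv_nth list_of_vec_index)
    moreover have "length (list_of_vec \<alpha>) = n" using \<alpha> by simp
    ultimately show "\<alpha> \<in> vec_of_list ` {xs. set xs \<subseteq> {..d} \<and> length xs = n}"
      by (intro image_eqI[of _ _ "list_of_vec \<alpha>"]) (auto simp: vec_list)
  qed
  show "finite (vec_of_list ` {xs. set xs \<subseteq> {..d} \<and> length xs = n})"
    by (intro finite_imageI finite_lists_length_eq) simp
qed

end

theory Submission
  imports Defs
begin

text \<open>
  Since \<open>f\<close> is an order isomorphism, \<open>f x\<close> is the number of predecessors of \<open>x\<close>, that is, the size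
  of the finite section at \<open>x\<close> of a Presburger definable relation. It is computed by summing out the
  \<open>n\<close> coordinates of the predecessor one at a time, each summation raising the degree by at most one.
  As a function of \<open>y\<close>, a piecewise polynomial function of \<open>(y, x)\<close> is a combination of terms
  \<open>h x * of_bool (\<tau> x \<le> y) * w (y mod M) * y ^ k\<close>, where \<open>\<tau>\<close> is a piecewise affine threshold; beyond the
  largest threshold it is quasi-polynomial in \<open>y\<close>, hence zero when its support is finite, and the
  remaining bounded sum is piecewise polynomial in \<open>x\<close>. The same separation of \<open>y\<close> from \<open>x\<close> yields
  quantifier elimination. It also shows, by induction on the dimension, that the pieces are finite
  disjoint unions of fundamental lattices: over a lattice on which the thresholds are affine, each
  piece is an arithmetic progression between two affine bounds.
\<close>

section \<open>Presburger predicates\<close>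

text \<open>The classes of predicates and functions are semantic: they consist of functions on
  infinite sequences of natural numbers, and N^n is the set \<open>Nvec n\<close> of sequences that
  vanish from index n on. The variable being isolated is always \<open>e 0\<close> and the others
  are \<open>tail e\<close>, so that eliminating or summing a variable is uniform in the number of
  remaining ones.

  Two obstacles shape the argument. A threshold involves a rounded quotient, which is neither a
  linear form nor a polynomial; on a residue class the division becomes exact, and this is why
  congruences accompany every step. Moreover, the periods of a fundamental lattice are independent,
  so each piece must be parametrised injectively by a full N^s, and inequalities between parameters
  have to be absorbed into a change of parameters. This is possible because an affine function with
  natural values on N^s has natural coefficients, which makes the region below its graph explicit
  enough to be cut up.

  The degree bound is bookkeeping: indicators have degree 0, thresholds degree 1, and a sum of k-th
  powers up to a threshold has degree k + 1.\<close>

type_synonym env = "nat \<Rightarrow> nat"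

abbreviation tail :: "env \<Rightarrow> env" where
  "tail e \<equiv> \<lambda>i. e (Suc i)"

lemma case_nat_tail [simp]: "case_nat (e 0) (tail e) = e"
  by (rule ext) (simp split: nat.split)

inductive affine_form :: "(env \<Rightarrow> int) \<Rightarrow> bool" where
  const: "affine_form (\<lambda>_. c)"
| var: "affine_form (\<lambda>e. int (e i))"
| add: "affine_form s \<Longrightarrow> affine_form t \<Longrightarrow> affine_form (\<lambda>e. s e + t e)"
| scale: "affine_form t \<Longrightarrow> affine_form (\<lambda>e. c * t e)"

lemma affine_form_diff:
  assumes "affine_form s" "affine_form t"
  shows "affine_form (\<lambda>e. s e - t e)"
  using affine_form.add[OF assms(1) affine_form.scale[OF assms(2), of "-1"]] by simp

lemma affine_form_tail: "affine_form t \<Longrightarrow> affine_form (\<lambda>e. t (tail e))"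
  by (induction rule: affine_form.induct) (auto intro: affine_form.intros)

lemma affine_form_case_nat:
  assumes "affine_form t"
  shows "\<exists>b s. affine_form s \<and> (\<forall>y e. t (case_nat y e) = b * int y + s e)"
  using assms
proof (induction rule: affine_form.induct)
  case (const c)
  show ?case by (rule exI[of _ 0], rule exI[of _ "\<lambda>_. c"]) (simp add: affine_form.const)
next
  case (var i)
  show ?case
  proof (cases i)
    case 0
    then show ?thesis
      by (intro exI[of _ 1] exI[of _ "\<lambda>_. 0"]) (simp add: affine_form.const)
  next
    case (Suc j)
    then show ?thesis
      by (intro exI[of _ 0] exI[of _ "\<lambda>e. int (e j)"]) (simp add: affine_form.var)
  qed
next
  case (add t u)
  then obtain b s b' s' where "affine_form s" "affine_form s'"
    "\<And>y e. t (case_nat y e) = b * int y + s e" "\<And>y e. u (case_nat y e) = b' * int y + s' e"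
    by blast
  then show ?case
    by (intro exI[of _ "b + b'"] exI[of _ "\<lambda>e. s e + s' e"])
      (simp add: affine_form.add algebra_simps)
next
  case (scale t c)
  then obtain b s where "affine_form s" "\<And>y e. t (case_nat y e) = b * int y + s e"
    by blast
  then show ?case
    by (intro exI[of _ "c * b"] exI[of _ "\<lambda>e. c * s e"])
      (simp add: affine_form.scale algebra_simps)
qed

lemma affine_form_tm_val: "affine_form (\<lambda>e. int (tm_val e t))"
  by (induction t) (auto intro: affine_form.intros)

text \<open>There is no rule for quantifiers; closure under existential quantification is proved as
  \<open>presb_ex\<close>. The divisibility atoms are what makes this closure possible.\<close>

inductive presb :: "(env \<Rightarrow> bool) \<Rightarrow> bool" where
  nonneg: "affine_form t \<Longrightarrow> presb (\<lambda>e. 0 \<le> t e)"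
| dvd: "affine_form t \<Longrightarrow> 0 < M \<Longrightarrow> presb (\<lambda>e. M dvd t e)"
| neg: "presb A \<Longrightarrow> presb (\<lambda>e. \<not> A e)"
| conj: "presb A \<Longrightarrow> presb B \<Longrightarrow> presb (\<lambda>e. A e \<and> B e)"

lemma presb_cong:
  assumes "presb A" and "\<And>e. A e = B e"
  shows "presb B"
proof -
  have "A = B" using assms(2) by (rule ext)
  then show ?thesis using assms(1) by simp
qed

lemma presb_disj: "presb A \<Longrightarrow> presb B \<Longrightarrow> presb (\<lambda>e. A e \<or> B e)"
  using presb.neg[OF presb.conj[OF presb.neg presb.neg, of A B]] by simp

lemma presb_const: "presb (\<lambda>_. b)"
  using presb.nonneg[OF affine_form.const[of 0]] presb.nonneg[OF affine_form.const[of "-1"]]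
  by (cases b) auto

lemma presb_if:
  assumes "presb C" "presb A" "presb B"
  shows "presb (\<lambda>e. if C e then A e else B e)"
proof -
  have "presb (\<lambda>e. (C e \<and> A e) \<or> (\<not> C e \<and> B e))"
    by (intro presb_disj presb.conj presb.neg assms)
  then show ?thesis by (rule presb_cong) auto
qed

lemma presb_Bex: "finite I \<Longrightarrow> (\<And>i. i \<in> I \<Longrightarrow> presb (A i)) \<Longrightarrow> presb (\<lambda>e. \<exists>i\<in>I. A i e)"
  by (induction I rule: finite_induct) (auto intro: presb_disj presb_const)

lemma presb_Ball: "finite I \<Longrightarrow> (\<And>i. i \<in> I \<Longrightarrow> presb (A i)) \<Longrightarrow> presb (\<lambda>e. \<forall>i\<in>I. A i e)"
  by (induction I rule: finite_induct) (auto intro: presb.conj presb_const)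

lemma presb_le: "affine_form s \<Longrightarrow> affine_form t \<Longrightarrow> presb (\<lambda>e. s e \<le> t e)"
  using presb.nonneg[OF affine_form_diff, of t s] by simp

lemma presb_less: "affine_form s \<Longrightarrow> affine_form t \<Longrightarrow> presb (\<lambda>e. s e < t e)"
  using presb.neg[OF presb_le, of t s] by (simp add: not_le)

lemma presb_tail: "presb A \<Longrightarrow> presb (\<lambda>e. A (tail e))"
  by (induction rule: presb.induct) (auto intro: presb.intros affine_form_tail)

lemma presb_mod:
  assumes "0 < M"
  shows "presb (\<lambda>e. e i mod M = (r :: nat))"
proof (cases "r < M")
  case True
  have "presb (\<lambda>e. int M dvd int (e i) - int r)"
    by (intro presb.dvd affine_form_diff affine_form.intros) (use assms in auto)
  moreover have "int M dvd int y - int r \<longleftrightarrow> y mod M = r" for y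
    using True by (metis mod_eq_dvd_iff mod_less of_nat_eq_iff zmod_int)
  ultimately show ?thesis by simp
next
  case False
  then have "e i mod M \<noteq> r" for e :: env
    using assms by (metis mod_less_divisor)
  then show ?thesis by (simp add: presb_const)
qed

section \<open>Thresholds and quantifier elimination\<close>

text \<open>Solving a linear inequality for one natural number y leaves a rounded quotient of an
  affine form as its bound. Truncation by \<open>nat\<close> is harmless: a negative lower bound on
  y says the same as the bound 0. Case distinctions belong to the class so that it contains maxima,
  minima and shifts depending on a residue.\<close>

inductive threshold :: "(env \<Rightarrow> nat) \<Rightarrow> bool" where
  div: "affine_form t \<Longrightarrow> 0 < b \<Longrightarrow> threshold (\<lambda>e. nat (t e div b))"
| if_then_else: "presb A \<Longrightarrow> threshold \<sigma> \<Longrightarrow> threshold \<tau> \<Longrightarrow> threshold (\<lambda>e. if A e then \<sigma> e else \<tau> e)"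

lemma threshold_cong:
  assumes "threshold \<sigma>" and "\<And>e. \<sigma> e = \<tau> e"
  shows "threshold \<tau>"
proof -
  have "\<sigma> = \<tau>" using assms(2) by (rule ext)
  then show ?thesis using assms(1) by simp
qed

lemma threshold_const: "threshold (\<lambda>_. c)"
  using threshold.div[OF affine_form.const[of "int c"], of 1] by simp

lemma int_div_less_iff:
  fixes a b n :: int
  assumes "0 < b"
  shows "a div b < n \<longleftrightarrow> a < n * b"
proof
  assume "a div b < n"
  then have "(a div b + 1) * b \<le> n * b" using assms by (intro mult_right_mono) auto
  moreover have "a < (a div b + 1) * b"
    using pos_mod_bound[OF assms, of a] div_mult_mod_eq[of a b] 
    unfolding distrib_right mult_1 by linarith
  ultimately show "a < n * b" by simp
next
  assume a: "a < n * b"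
  show "a div b < n"
  proof (rule ccontr)
    assume "\<not> a div b < n"
    then have "n * b \<le> (a div b) * b" using assms by (intro mult_right_mono) auto
    then show False
      using a pos_mod_sign[OF assms, of a] div_mult_mod_eq[of a b] by linarith
  qed
qed

lemma mult_nat_div_eq:
  fixes t b r :: int
  assumes "0 < b" "0 \<le> t" "r \<in> {0..<b}" "b dvd t - r"
  shows "b * int (nat (t div b)) = t - r"
proof -
  have "r = t mod b"
    using assms by (metis atLeastLessThan_iff mod_eq_dvd_iff mod_pos_pos_trivial)
  moreover have "0 \<le> t div b" using assms by (simp add: pos_imp_zdiv_nonneg_iff)
  ultimately show ?thesis by (simp add: minus_mod_eq_mult_div)
qed

text \<open>A rounded quotient y of \<open>t\<close> by b cannot be put into a linear atom directly.
  Where \<open>t\<close> is nonnegative with remainder r, however, b * y = t - r, so the atom is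
  multiplied by b, and the remainder is guessed by a finite disjunction. Where \<open>t\<close> is
  negative, y is 0. Case distinctions in the threshold turn into case distinctions of
  predicates.\<close>

lemma presb_subst:
  assumes "threshold \<tau>" "presb A"
  shows "presb (\<lambda>e. A (case_nat (\<tau> e) e))"
  using assms
proof (induction \<tau> arbitrary: A rule: threshold.induct)
  case (div t b)
  note t = div.hyps
  let ?y = "\<lambda>e. nat (t e div b)"
  \<comment> \<open>\<open>P\<close> is the condition that the atom imposes on its affine form, and
    \<open>Q\<close> is the equivalent condition on b times that form: the same one for a sign,
    divisibility by b * M for divisibility by M.\<close>
  have atom: "presb (\<lambda>e. P (u (case_nat (?y e) e)))"
    if u: "affine_form u" and Q: "\<And>v. affine_form v \<Longrightarrow> presb (\<lambda>e. Q (v e))"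
      and P: "\<And>v. affine_form v \<Longrightarrow> presb (\<lambda>e. P (v e))" and PQ: "\<And>x. Q (b * x) \<longleftrightarrow> P x"
    for u and P Q :: "int \<Rightarrow> bool"
  proof -
    obtain s a where s: "affine_form s" and us: "\<forall>y e. u (case_nat y e) = a * int y + s e"
    using affine_form_case_nat[OF u] by blast
    have "P (u (case_nat (?y e) e)) \<longleftrightarrow>
       (if 0 \<le> t e then \<exists>r\<in>{0..<b}. b dvd t e - r \<and> Q (a * (t e - r) + b * s e) else P (s e))" for e
    proof (cases "0 \<le> t e")
      case True
      have "P (u (case_nat (?y e) e)) \<longleftrightarrow> Q (a * (t e - r) + b * s e)"
        if "r \<in> {0..<b}" "b dvd t e - r" for r
      proof -
        have "a * (t e - r) + b * s e = b * u (case_nat (?y e) e)"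
          unfolding mult_nat_div_eq[OF t(2) True that, symmetric] us[rule_format]
          by (simp add: algebra_simps)
        then show ?thesis by (simp add: PQ)
      qed
      moreover have "\<exists>r\<in>{0..<b}. b dvd t e - r"
        using t(2) by (intro bexI[of _ "t e mod b"]) auto
      ultimately show ?thesis
        using True by (metis (no_types, lifting))
    next
      case False
      then have "t e div b < 0" using t(2) by (simp add: pos_imp_zdiv_neg_iff)
      then have "?y e = 0" by simp
      then show ?thesis using False us[rule_format, of 0 e] by simp
    qed
    moreover have "presb (\<lambda>e. if 0 \<le> t e then \<exists>r\<in>{0..<b}. b dvd t e - r \<and>
        Q (a * (t e - r) + b * s e) else P (s e))"
      by (intro presb_if presb_Bex presb.conj presb.nonneg presb.dvd Q P affine_form.intros
          affine_form_diff t s) auto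
    ultimately show ?thesis by simp
  qed
  from div.prems show ?case
  proof (induction rule: presb.induct)
    case (nonneg u)
    show ?case
      by (rule atom[where Q = "\<lambda>x. 0 \<le> x"])
        (use nonneg t in \<open>auto intro: presb.nonneg simp: zero_le_mult_iff\<close>)
  next
    case (dvd u M)
    show ?case
      by (rule atom[where P = "\<lambda>x. M dvd x" and Q = "\<lambda>x. b * M dvd x"])
        (use dvd t in \<open>auto intro: presb.dvd\<close>)
  qed (auto intro: presb.intros)
next
  case (if_then_else B \<sigma> \<tau>)
  have "presb (\<lambda>e. if B e then A (case_nat (\<sigma> e) e) else A (case_nat (\<tau> e) e))"
    by (intro presb_if if_then_else)
  then show ?case by (rule presb_cong) auto
qed

lemma presb_threshold_le:
  assumes "threshold \<tau>"
  shows "presb (\<lambda>e. \<tau> (tail e) \<le> e 0)"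
  using assms
proof (induction rule: threshold.induct)
  case (div t b)
  have "nat (t (tail e) div b) \<le> e 0 \<longleftrightarrow> t (tail e) < b * int (e 0) + b" for e :: env
  proof -
    have "nat (t (tail e) div b) \<le> e 0 \<longleftrightarrow> t (tail e) div b < int (e 0) + 1" by auto
    also have "\<dots> \<longleftrightarrow> t (tail e) < (int (e 0) + 1) * b"
      using div.hyps(2) by (rule int_div_less_iff)
    finally show ?thesis by (simp add: algebra_simps)
  qed
  moreover have "presb (\<lambda>e. t (tail e) < b * int (e 0) + b)"
    by (intro presb_less affine_form_tail[OF div.hyps(1)] affine_form.intros)
  ultimately show ?case by simp
next
  case (if_then_else A \<sigma> \<tau>)
  have "presb (\<lambda>e. if A (tail e) then \<sigma> (tail e) \<le> e 0 else \<tau> (tail e) \<le> e 0)"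
    by (intro presb_if presb_tail[OF if_then_else.hyps(1)] if_then_else.IH)
  then show ?case by (rule presb_cong) auto
qed

lemma presb_le_threshold:
  assumes "threshold \<sigma>" "threshold \<tau>"
  shows "presb (\<lambda>e. \<sigma> e \<le> \<tau> e)"
  using presb_subst[OF assms(2) presb_threshold_le[OF assms(1)]] by simp

lemma presb_threshold_mod:
  assumes "threshold \<tau>" "0 < M"
  shows "presb (\<lambda>e. \<tau> e mod M = r)"
  using presb_subst[OF assms(1) presb_mod[OF assms(2), of 0]] by simp

section \<open>Closure properties of thresholds\<close>

lemma threshold_max:
  assumes "threshold \<sigma>" "threshold \<tau>"
  shows "threshold (\<lambda>e. max (\<sigma> e) (\<tau> e))"
  unfolding max_def by (intro threshold.if_then_else presb_le_threshold assms)

lemma threshold_min: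
  assumes "threshold \<sigma>" "threshold \<tau>"
  shows "threshold (\<lambda>e. min (\<sigma> e) (\<tau> e))"
  unfolding min_def by (intro threshold.if_then_else presb_le_threshold assms)

lemma threshold_Max:
  "finite T \<Longrightarrow> T \<noteq> {} \<Longrightarrow> \<forall>\<tau>\<in>T. threshold \<tau> \<Longrightarrow> threshold (\<lambda>e. Max ((\<lambda>\<tau>. \<tau> e) ` T))"
  by (induction T rule: finite_ne_induct) (auto intro: threshold_max)

lemma threshold_Min:
  "finite T \<Longrightarrow> T \<noteq> {} \<Longrightarrow> \<forall>\<tau>\<in>T. threshold \<tau> \<Longrightarrow> threshold (\<lambda>e. Min ((\<lambda>\<tau>. \<tau> e) ` T))"
  by (induction T rule: finite_ne_induct) (auto intro: threshold_min)

lemma threshold_add_const: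
  assumes "threshold \<tau>"
  shows "threshold (\<lambda>e. \<tau> e + j)"
  using assms
proof (induction rule: threshold.induct)
  case (div t b)
  have "nat (t e div b) + j = (if 0 \<le> t e then nat ((t e + b * int j) div b) else j)" for e
    using div.hyps
    by (auto simp: pos_imp_zdiv_nonneg_iff nat_add_distrib pos_imp_zdiv_neg_iff not_le less_imp_le)
  moreover have "threshold (\<lambda>e. if 0 \<le> t e then nat ((t e + b * int j) div b) else j)"
    by (intro threshold.intros presb.nonneg affine_form.intros threshold_const div.hyps)
  ultimately show ?case by simp
next
  case (if_then_else A \<sigma> \<tau>)
  have "threshold (\<lambda>e. if A e then \<sigma> e + j else \<tau> e + j)"
    by (intro threshold.if_then_else if_then_else)
  then show ?case by (rule threshold_cong) auto
qed

text \<open>A residue modulo M takes finitely many values, so the shift is a nested case distinction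
  between constant shifts. It serves to round a threshold up to a given residue class.\<close>

lemma threshold_add_mod:
  assumes "threshold \<tau>" "0 < M"
  shows "threshold (\<lambda>e. \<tau> e + g (\<tau> e mod M))"
proof -
  \<comment> \<open>\<open>K\<close> counts the residues that have already been treated; at K = M
    the condition is always true.\<close>
  have "threshold (\<lambda>e. \<tau> e + (if \<tau> e mod M < K then g (\<tau> e mod M) else 0))" for K
  proof (induction K)
    case 0
    then show ?case using assms by simp
  next
    case (Suc K)
    have "threshold (\<lambda>e. if \<tau> e mod M = K then \<tau> e + g K
        else \<tau> e + (if \<tau> e mod M < K then g (\<tau> e mod M) else 0))"
      by (intro threshold.if_then_else presb_threshold_mod threshold_add_const assms Suc)
    then show ?case by (rule threshold_cong) (auto simp: less_Suc_eq)
  qed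
  from this[of M] show ?thesis using assms by simp
qed

section \<open>Isolating the first variable and eliminating it\<close>

inductive separated :: "(env \<Rightarrow> bool) \<Rightarrow> bool" where
  threshold: "threshold \<tau> \<Longrightarrow> separated (\<lambda>e. \<tau> (tail e) \<le> e 0)"
| mod: "0 < M \<Longrightarrow> separated (\<lambda>e. e 0 mod M = r)"
| tail: "presb A \<Longrightarrow> separated (\<lambda>e. A (tail e))"
| neg: "separated A \<Longrightarrow> separated (\<lambda>e. \<not> A e)"
| conj: "separated A \<Longrightarrow> separated B \<Longrightarrow> separated (\<lambda>e. A e \<and> B e)"

lemma separated_disj: "separated A \<Longrightarrow> separated B \<Longrightarrow> separated (\<lambda>e. A e \<or> B e)"
  using separated.neg[OF separated.conj[OF separated.neg separated.neg, of A B]] by simp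

lemma separated_Bex:
  "finite I \<Longrightarrow> (\<And>i. i \<in> I \<Longrightarrow> separated (A i)) \<Longrightarrow> separated (\<lambda>e. \<exists>i\<in>I. A i e)"
  by (induction I rule: finite_induct)
    (auto intro: separated_disj separated.tail[OF presb_const])

lemma separated_mult_ge:
  assumes s: "affine_form s" and b: "0 < b"
  shows "separated (\<lambda>e. s (tail e) \<le> b * int (e 0))"
proof -
  \<comment> \<open>Adding b - 1 before the division turns the floor into the ceiling of s / b,
    which is the least integer y with s \<le> b * y.\<close>
  have "nat ((s (tail e) + (b - 1)) div b) \<le> e 0 \<longleftrightarrow> s (tail e) \<le> b * int (e 0)" for e :: env
  proof -
    have "nat ((s (tail e) + (b - 1)) div b) \<le> e 0 \<longleftrightarrow> (s (tail e) + (b - 1)) div b < int (e 0) + 1"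
      by auto
    also have "\<dots> \<longleftrightarrow> s (tail e) + (b - 1) < (int (e 0) + 1) * b"
      using b by (rule int_div_less_iff)
    finally show ?thesis by (auto simp: algebra_simps)
  qed
  moreover have "separated (\<lambda>e. nat ((s (tail e) + (b - 1)) div b) \<le> e 0)"
    by (rule separated.threshold[where \<tau> = "\<lambda>e. nat ((s e + (b - 1)) div b)"])
      (intro threshold.div affine_form.intros s b)
  ultimately show ?thesis by simp
qed

text \<open>The sign of the coefficient of \<open>e 0\<close> decides: a positive one yields a lower
  bound, a negative one an upper bound, which is the negation of a lower bound shifted by one. A
  divisibility by M depends on \<open>e 0\<close> only through its residue modulo M, and branching
  over the residue leaves a condition on the tail.\<close>

lemma presb_imp_separated:
  assumes "presb A"
  shows "separated A"
  using assms
proof (induction rule: presb.induct)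
  case (nonneg t)
  obtain s b where s: "affine_form s" and t: "\<forall>y e. t (case_nat y e) = b * int y + s e"
    using affine_form_case_nat[OF nonneg] by blast
  have te: "t e = b * int (e 0) + s (tail e)" for e
    using t[rule_format, of "e 0" "tail e"] by simp
  consider "b = 0" | "b > 0" | "b < 0" by linarith
  then show ?case
  proof cases
    case 1
    then show ?thesis
      unfolding te using separated.tail[OF presb.nonneg[OF s]] by simp
  next
    case 2
    have "separated (\<lambda>e. (-1) * s (tail e) \<le> b * int (e 0))"
      by (rule separated_mult_ge[OF affine_form.scale[OF s] 2])
    moreover have "(-1) * s (tail e) \<le> b * int (e 0) \<longleftrightarrow> 0 \<le> b * int (e 0) + s (tail e)" for e :: env
      by auto
    ultimately show ?thesis unfolding te by simp
  next
    case 3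
    have "separated (\<lambda>e. \<not> (s (tail e) + 1 \<le> (- b) * int (e 0)))"
      by (rule separated.neg, rule separated_mult_ge[where s = "\<lambda>e. s e + 1"])
        (use 3 s in \<open>auto intro: affine_form.intros\<close>)
    moreover have "\<not> (s (tail e) + 1 \<le> (- b) * int (e 0)) \<longleftrightarrow> 0 \<le> b * int (e 0) + s (tail e)" for e :: env
      by auto
    ultimately show ?thesis unfolding te by (simp only:)
  qed
next
  case (dvd t M)
  obtain s b where s: "affine_form s" and t: "\<forall>y e. t (case_nat y e) = b * int y + s e"
    using affine_form_case_nat[OF dvd.hyps(1)] by blast
  have "M dvd t e \<longleftrightarrow> (\<exists>r\<in>{..<nat M}. e 0 mod nat M = r \<and> M dvd b * int r + s (tail e))" for e
  proof -
    have "int (e 0 mod nat M) = int (e 0) mod M"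
      using dvd.hyps(2) by (simp add: zmod_int)
    then have "M dvd b * int (e 0 mod nat M) - b * int (e 0)"
      by (metis dvd_minus_mod dvd_mult minus_diff_eq dvd_minus_iff right_diff_distrib')
    then have "M dvd t e + (b * int (e 0 mod nat M) - b * int (e 0)) \<longleftrightarrow> M dvd t e"
      by (rule dvd_add_left_iff)
    moreover have "t e + (b * int (e 0 mod nat M) - b * int (e 0)) = b * int (e 0 mod nat M) + s (tail e)"
      using t[rule_format, of "e 0" "tail e"] unfolding case_nat_tail by simp
    ultimately have "M dvd t e \<longleftrightarrow> M dvd b * int (e 0 mod nat M) + s (tail e)"
      by simp
    moreover have "e 0 mod nat M \<in> {..<nat M}" using dvd.hyps(2) by simp
    ultimately show ?thesis by auto
  qed
  moreover have "separated (\<lambda>e. \<exists>r\<in>{..<nat M}. e 0 mod nat M = r \<and> M dvd b * int r + s (tail e))"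
  proof (rule separated_Bex)
    fix r assume "r \<in> {..<nat M}"
    have "presb (\<lambda>e. M dvd b * int r + s e)"
      by (intro presb.dvd affine_form.add affine_form.const s dvd.hyps)
    then have "separated (\<lambda>e. M dvd b * int r + s (tail e))"
      by (rule separated.tail)
    then show "separated (\<lambda>e. e 0 mod nat M = r \<and> M dvd b * int r + s (tail e))"
      by (intro separated.conj separated.mod) (use dvd.hyps in auto)
  qed simp
  ultimately show ?case by simp
qed (auto intro: separated.intros)

text \<open>\<open>T\<close> and \<open>M\<close> are the same for all e. When \<open>T\<close> is
  finite and \<open>M\<close> positive, the values of the first variable therefore fall into
  boundedly many classes, each an interval intersected with a residue class, on which
  \<open>A\<close> is constant.\<close>

definition determined_by :: "(env \<Rightarrow> nat) set \<Rightarrow> nat \<Rightarrow> (env \<Rightarrow> bool) \<Rightarrow> bool" where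
  "determined_by T M A \<longleftrightarrow> (\<forall>e y z. y mod M = z mod M \<longrightarrow> (\<forall>\<tau>\<in>T. \<tau> e \<le> y \<longleftrightarrow> \<tau> e \<le> z) \<longrightarrow>
     A (case_nat y e) = A (case_nat z e))"

text \<open>The constant 0 is put among the thresholds so that some threshold is at most y for every
  y, and hence a largest such threshold exists. For a conjunction, the product of the two moduli
  determines both residues.\<close>

lemma presb_determined_by:
  assumes "presb A"
  obtains T M where "finite T" "\<forall>\<tau>\<in>T. threshold \<tau>" "(\<lambda>_. 0) \<in> T" "0 < M" "determined_by T M A"
proof -
  from presb_imp_separated[OF assms]
  have "\<exists>T M. finite T \<and> (\<forall>\<tau>\<in>T. threshold \<tau>) \<and> 0 < M \<and> determined_by T M A"
  proof (induction rule: separated.induct)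
    case (threshold \<tau>)
    then show ?case
      by (intro exI[of _ "{\<tau>}"] exI[of _ 1]) (simp add: determined_by_def)
  next
    case (mod M r)
    then show ?case
      by (intro exI[of _ "{}"] exI[of _ M]) (simp add: determined_by_def)
  next
    case (tail A)
    then show ?case
      by (intro exI[of _ "{}"] exI[of _ 1]) (simp add: determined_by_def)
  next
    case (neg A)
    then show ?case by (simp add: determined_by_def)
  next
    case (conj A B)
    then obtain T M T' M' where *: "finite T" "\<forall>\<tau>\<in>T. threshold \<tau>" "0 < M" "determined_by T M A"
      "finite T'" "\<forall>\<tau>\<in>T'. threshold \<tau>" "0 < M'" "determined_by T' M' B"
      by blast
    have "y mod M = z mod M \<and> y mod M' = z mod M'" if "y mod (M * M') = z mod (M * M')" for y z
      using that by (metis mod_mod_cancel dvd_triv_left dvd_triv_right)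
    then have "determined_by (T \<union> T') (M * M') (\<lambda>e. A e \<and> B e)"
      using *(4,8) unfolding determined_by_def by (metis UnCI)
    then show ?case
      using * by (intro exI[of _ "T \<union> T'"] exI[of _ "M * M'"]) auto
  qed
  then obtain T M where *: "finite T" "\<forall>\<tau>\<in>T. threshold \<tau>" "0 < M" "determined_by T M A"
    by blast
  moreover have "determined_by (insert (\<lambda>_. 0) T) M A"
    using *(4) unfolding determined_by_def by blast
  ultimately show thesis
    using that[of "insert (\<lambda>_. 0) T" M] by (simp add: threshold_const)
qed

text \<open>A witness may be lowered by multiples of M as long as it passes below none of the
  thresholds that it reaches. It thereby arrives at one of the M values starting at the largest of
  these thresholds, so that the quantifier becomes a finite disjunction of substitutions.\<close>

lemma presb_ex:
  assumes "presb A"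
  shows "presb (\<lambda>e. \<exists>y. A (case_nat y e))"
proof -
  obtain T M where T: "finite T" "\<forall>\<tau>\<in>T. threshold \<tau>" "(\<lambda>_. 0) \<in> T" and M: "0 < M"
    and det: "determined_by T M A"
    using presb_determined_by[OF assms] .
  have "\<exists>\<tau>\<in>T. \<exists>j\<in>{..<M}. A (case_nat (\<tau> e + j) e)" if y: "A (case_nat y e)" for y e
  proof -
    let ?S = "{\<tau> \<in> T. \<tau> e \<le> y}"
    have "finite ((\<lambda>\<tau>. \<tau> e) ` ?S)" "(\<lambda>\<tau>. \<tau> e) ` ?S \<noteq> {}" using T by auto
    from Max_in[OF this] Max_ge[OF this(1)] obtain \<tau> where
      \<tau>: "\<tau> \<in> ?S" "\<And>\<sigma>. \<sigma> \<in> ?S \<Longrightarrow> \<sigma> e \<le> \<tau> e" by auto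
    let ?z = "\<tau> e + (y - \<tau> e) mod M"
    have le: "?z \<le> y"
      using \<tau>(1) mod_less_eq_dividend[of "y - \<tau> e" M] unfolding mem_Collect_eq by linarith
    have "y mod M = ?z mod M"
      using \<tau>(1) by (simp add: mod_add_right_eq)
    moreover have "\<sigma> e \<le> y \<longleftrightarrow> \<sigma> e \<le> ?z" if "\<sigma> \<in> T" for \<sigma>
      using \<tau>(2)[of \<sigma>] that le by fastforce
    ultimately have "A (case_nat ?z e)"
      using det y unfolding determined_by_def by blast
    moreover have "\<tau> \<in> T" "(y - \<tau> e) mod M \<in> {..<M}" using \<tau>(1) M by auto
    ultimately show ?thesis by blast
  qed
  then have "(\<exists>y. A (case_nat y e)) \<longleftrightarrow> (\<exists>\<tau>\<in>T. \<exists>j\<in>{..<M}. A (case_nat (\<tau> e + j) e))" for e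
    by blast
  moreover have "presb (\<lambda>e. A (case_nat (\<tau> e + j) e))" if "\<tau> \<in> T" for \<tau> j
    by (rule presb_subst[OF threshold_add_const assms]) (use T that in auto)
  then have "presb (\<lambda>e. \<exists>\<tau>\<in>T. \<exists>j\<in>{..<M}. A (case_nat (\<tau> e + j) e))"
    by (intro presb_Bex T finite_lessThan)
  ultimately show ?thesis by simp
qed

lemma presb_sat: "presb (\<lambda>e. sat e \<phi>)"
proof (induction \<phi>)
  case (Eq s t)
  have "presb (\<lambda>e. int (tm_val e s) \<le> int (tm_val e t) \<and> int (tm_val e t) \<le> int (tm_val e s))"
    by (intro presb.conj presb_le affine_form_tm_val)
  then show ?case by (rule presb_cong) auto
qed (auto intro: presb.intros presb_ex)

section \<open>Summation of piecewise polynomial functions\<close>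

inductive pwpoly :: "nat \<Rightarrow> (env \<Rightarrow> rat) \<Rightarrow> bool" where
  const: "pwpoly d (\<lambda>_. c)"
| var: "pwpoly (Suc d) (\<lambda>e. of_nat (e i))"
| indicator: "presb A \<Longrightarrow> pwpoly d (\<lambda>e. of_bool (A e))"
| add: "pwpoly d f \<Longrightarrow> pwpoly d g \<Longrightarrow> pwpoly d (\<lambda>e. f e + g e)"
| mult: "pwpoly d f \<Longrightarrow> pwpoly d' g \<Longrightarrow> pwpoly (d + d') (\<lambda>e. f e * g e)"

lemma pwpoly_cong:
  assumes "pwpoly d f" and "\<And>e. f e = g e"
  shows "pwpoly d g"
proof -
  have "f = g" using assms(2) by (rule ext)
  then show ?thesis using assms(1) by simp
qed

lemma pwpoly_mono:
  assumes "pwpoly d f" "d \<le> d'"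
  shows "pwpoly d' f"
  using pwpoly.mult[OF assms(1) pwpoly.const[of "d' - d" 1]] assms(2) by simp

lemma pwpoly_mult0: "pwpoly 0 f \<Longrightarrow> pwpoly d g \<Longrightarrow> pwpoly d (\<lambda>e. f e * g e)"
  using pwpoly.mult[of 0 f d g] by simp

lemma pwpoly_diff: "pwpoly d f \<Longrightarrow> pwpoly d g \<Longrightarrow> pwpoly d (\<lambda>e. f e - g e)"
  using pwpoly.add[OF _ pwpoly_mult0[OF pwpoly.const[of 0 "-1"]], of d f g] by simp

lemma pwpoly_power: "pwpoly d f \<Longrightarrow> pwpoly (d * k) (\<lambda>e. f e ^ k)"
  by (induction k) (auto intro: pwpoly.intros)

lemma pwpoly_sum:
  "finite I \<Longrightarrow> (\<And>i. i \<in> I \<Longrightarrow> pwpoly d (f i)) \<Longrightarrow> pwpoly d (\<lambda>e. \<Sum>i\<in>I. f i e)"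
  by (induction I rule: finite_induct) (auto intro: pwpoly.intros)

lemma pwpoly_if:
  assumes "presb A" "pwpoly d f" "pwpoly d g"
  shows "pwpoly d (\<lambda>e. if A e then f e else g e)"
proof -
  have "pwpoly d (\<lambda>e. of_bool (A e) * f e + of_bool (\<not> A e) * g e)"
    by (intro pwpoly.add pwpoly_mult0 pwpoly.indicator presb.neg assms)
  then show ?thesis by (rule pwpoly_cong) auto
qed

lemma pwpoly_affine_form: "affine_form t \<Longrightarrow> pwpoly 1 (\<lambda>e. of_int (t e))"
proof (induction rule: affine_form.induct)
  case (var i)
  show ?case using pwpoly.var[of 0 i] by simp
next
  case (scale t c)
  then show ?case using pwpoly_mult0[OF pwpoly.const] by simp
qed (auto intro: pwpoly.intros)

lemma pwpoly_threshold:
  assumes "threshold \<tau>"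
  shows "pwpoly 1 (\<lambda>e. of_nat (\<tau> e))"
  using assms
proof (induction rule: threshold.induct)
  case (div t b)
  \<comment> \<open>The quotient is split according to the remainder r of \<open>t\<close> modulo b.
    Exactly one of the indicators is 1, and there the quotient equals (t - r) / b, which is affine
    with rational coefficients.\<close>
  let ?f = "\<lambda>e. if 0 \<le> t e
    then \<Sum>r\<in>{0..<b}. of_bool (b dvd t e - r) * ((1 / of_int b) * of_int (t e + (- r))) else (0::rat)"
  have "pwpoly 1 ?f"
    by (intro pwpoly_if presb.nonneg pwpoly_sum pwpoly_mult0 pwpoly.indicator presb.dvd
        affine_form_diff affine_form.add affine_form.const div.hyps pwpoly.const
        pwpoly_affine_form) auto
  then show ?case
  proof (rule pwpoly_cong)
    fix e
    show "?f e = of_nat (nat (t e div b))"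
    proof (cases "0 \<le> t e")
      case True
      let ?r = "t e mod b"
      have dvd_iff: "b dvd t e - r \<longleftrightarrow> r = ?r" if "r \<in> {0..<b}" for r
        using that by (metis atLeastLessThan_iff mod_eq_dvd_iff mod_pos_pos_trivial)
      have "?f e = (\<Sum>r\<in>{0..<b}. of_bool (b dvd t e - r) * ((1 / of_int b) * of_int (t e + (- r))))"
        by (simp only: True if_True)
      also have "\<dots> = (\<Sum>r\<in>{0..<b}. if r = ?r then of_int (t e - r) / of_int b else 0)"
        by (rule sum.cong) (simp_all add: dvd_iff)
      also have "\<dots> = of_int (t e - ?r) / of_int b"
        using div.hyps(2) by (subst sum.delta) auto
      also have "\<dots> = of_int (t e div b)"
        using div.hyps(2) by (simp add: minus_mod_eq_mult_div)
      also have "\<dots> = of_nat (nat (t e div b))"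
        using True div.hyps(2) by (simp add: pos_imp_zdiv_nonneg_iff)
      finally show ?thesis .
    next
      case False
      then show ?thesis
        using div.hyps(2) by (simp add: div_nonpos_pos_le0)
    qed
  qed
next
  case (if_then_else A \<sigma> \<tau>)
  have "pwpoly 1 (\<lambda>e. if A e then of_nat (\<sigma> e) else of_nat (\<tau> e))"
    by (intro pwpoly_if if_then_else)
  then show ?case by (rule pwpoly_cong) auto
qed

section \<open>Sums of powers with periodic weights\<close>

lemma pwpoly_threshold_power:
  assumes "threshold \<tau>"
  shows "pwpoly k (\<lambda>e. of_nat (\<tau> e) ^ k)"
  using pwpoly_power[OF pwpoly_threshold[OF assms], of k] by simp

lemma pwpoly_periodic:
  fixes w :: "nat \<Rightarrow> rat"
  assumes "threshold \<tau>" "0 < M"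
  shows "pwpoly 0 (\<lambda>e. w (\<tau> e mod M))"
proof -
  have "pwpoly 0 (\<lambda>e. \<Sum>s<M. of_bool (\<tau> e mod M = s) * w s)"
    by (intro pwpoly_sum pwpoly_mult0 pwpoly.indicator presb_threshold_mod assms pwpoly.const) auto
  then show ?thesis
  proof (rule pwpoly_cong)
    fix e
    have "(\<Sum>s<M. of_bool (\<tau> e mod M = s) * w s) = (\<Sum>s<M. if s = \<tau> e mod M then w s else 0)"
      by (intro sum.cong) auto
    also have "\<dots> = w (\<tau> e mod M)" using assms(2) by (subst sum.delta) auto
    finally show "(\<Sum>s<M. of_bool (\<tau> e mod M = s) * w s) = w (\<tau> e mod M)" .
  qed
qed

text \<open>Telescoping with stride M leaves M boundary terms at either end.\<close>

lemma sum_shift_diff: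
  fixes h :: "nat \<Rightarrow> rat"
  shows "(\<Sum>y<Y. h (y + M) - h y) = (\<Sum>i<M. h (Y + i)) - (\<Sum>i<M. h i)"
proof (induction Y)
  case (Suc Y)
  have "(\<Sum>i<M. h (Suc Y + i)) + h Y = (\<Sum>i<Suc M. h (Y + i))"
    by (subst sum.lessThan_Suc_shift) simp
  then show ?case using Suc by (simp add: algebra_simps)
qed simp

text \<open>
  Telescoping \<open>w (y mod M) * ((y + M) ^ Suc k - y ^ Suc k)\<close> expresses the sum of the \<open>k\<close>-th
  powers through boundary terms and the sums of lower powers.
\<close>

lemma pwpoly_power_sum:
  fixes w :: "nat \<Rightarrow> rat"
  assumes "threshold \<tau>" "0 < M"
  shows "pwpoly (Suc k) (\<lambda>e. \<Sum>y<\<tau> e. w (y mod M) * of_nat y ^ k)"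
proof (induction k rule: less_induct)
  case (less k)
  let ?F = "\<lambda>k Y. \<Sum>y<Y. w (y mod M) * of_nat y ^ k"
  let ?c = "\<lambda>j. of_nat (Suc k choose j) * of_nat M ^ (Suc k - j) :: rat"
  let ?B = "\<lambda>Y. (\<Sum>i<M. w ((Y + i) mod M) * of_nat (Y + i) ^ Suc k)"
  \<comment> \<open>The shift by M does not affect the weight, so the top term of the binomial
    expansion of (y + M)^(k + 1) cancels. The term of exponent k keeps the nonzero factor (k + 1) *
    M, and the equation can be solved for \<open>?F k Y\<close>.\<close>
  have rec: "?B Y - ?B 0 = (\<Sum>j<k. ?c j * ?F j Y) + of_nat (Suc k * M) * ?F k Y" for Y
  proof -
    have "?B Y - ?B 0 =
        (\<Sum>y<Y. w ((y + M) mod M) * of_nat (y + M) ^ Suc k - w (y mod M) * of_nat y ^ Suc k)"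
      using sum_shift_diff[of "\<lambda>y. w (y mod M) * of_nat y ^ Suc k" M Y] by simp
    also have "\<dots> = (\<Sum>y<Y. \<Sum>j<Suc k. ?c j * (w (y mod M) * of_nat y ^ j))"
    proof (rule sum.cong[OF refl])
      fix y
      have "(of_nat (y + M) :: rat) ^ Suc k =
          (\<Sum>j\<le>Suc k. of_nat (Suc k choose j) * of_nat y ^ j * of_nat M ^ (Suc k - j))"
        by (simp only: of_nat_add binomial_ring)
      also have "\<dots> = (\<Sum>j<Suc k. ?c j * of_nat y ^ j) + of_nat y ^ Suc k"
        by (simp only: lessThan_Suc_atMost[symmetric] sum.lessThan_Suc[of _ "Suc k"])
          (simp add: ac_simps)
      finally show "w ((y + M) mod M) * of_nat (y + M) ^ Suc k - w (y mod M) * of_nat y ^ Suc k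
          = (\<Sum>j<Suc k. ?c j * (w (y mod M) * of_nat y ^ j))"
        by (simp only: mod_add_self2 distrib_left sum_distrib_left) (simp add: ac_simps)
    qed
    also have "\<dots> = (\<Sum>j<Suc k. ?c j * ?F j Y)"
      by (subst sum.swap) (simp only: sum_distrib_left)
    finally show ?thesis by (simp add: algebra_simps)
  qed
  have "pwpoly (Suc k) (\<lambda>e. (1 / of_nat (Suc k * M)) *
      ((\<Sum>i<M. w ((\<tau> e + i) mod M) * of_nat (\<tau> e + i) ^ Suc k) - ?B 0 - (\<Sum>j<k. ?c j * ?F j (\<tau> e))))"
  proof (intro pwpoly_mult0 pwpoly_diff pwpoly_sum pwpoly.const)
    fix i
    have "threshold (\<lambda>e. \<tau> e + i)" by (rule threshold_add_const[OF assms(1)])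
    then show "pwpoly 0 (\<lambda>e. w ((\<tau> e + i) mod M))"
      and "pwpoly (Suc k) (\<lambda>e. of_nat (\<tau> e + i) ^ Suc k)"
      using pwpoly_periodic[OF _ assms(2)] pwpoly_threshold_power by blast+
  next
    fix j assume "j \<in> {..<k}"
    then show "pwpoly (Suc k) (\<lambda>e. ?F j (\<tau> e))"
      using less.IH[of j] by (auto intro: pwpoly_mono)
  qed auto
  then show ?case
  proof (rule pwpoly_cong)
    fix e
    have "(\<Sum>i<M. w ((\<tau> e + i) mod M) * of_nat (\<tau> e + i) ^ Suc k) - ?B 0 - (\<Sum>j<k. ?c j * ?F j (\<tau> e))
      = of_nat (Suc k * M) * ?F k (\<tau> e)"
      using rec[of "\<tau> e"] by (simp only: algebra_simps)
    then show "(1 / of_nat (Suc k * M)) *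
      ((\<Sum>i<M. w ((\<tau> e + i) mod M) * of_nat (\<tau> e + i) ^ Suc k) - ?B 0 - (\<Sum>j<k. ?c j * ?F j (\<tau> e)))
      = ?F k (\<tau> e)"
      using assms(2) by (simp del: of_nat_mult)
  qed
qed

section \<open>Functions in which the first variable is separated from the others\<close>

inductive separated_fun :: "nat \<Rightarrow> (env \<Rightarrow> rat) \<Rightarrow> bool" where
  base: "threshold \<tau> \<Longrightarrow> 0 < M \<Longrightarrow> pwpoly d h \<Longrightarrow>
    separated_fun (d + k) (\<lambda>e. h (tail e) * of_bool (\<tau> (tail e) \<le> e 0) * w (e 0 mod M) * of_nat (e 0) ^ k)"
| add: "separated_fun d f \<Longrightarrow> separated_fun d g \<Longrightarrow> separated_fun d (\<lambda>e. f e + g e)"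

lemma separated_fun_cong:
  assumes "separated_fun d f" and "\<And>e. f e = g e"
  shows "separated_fun d g"
proof -
  have "f = g" using assms(2) by (rule ext)
  then show ?thesis using assms(1) by simp
qed

lemma separated_fun_base:
  assumes "threshold \<tau>" "0 < M" "pwpoly d h" "D = d + k"
    and "\<And>e. f e = h (tail e) * of_bool (\<tau> (tail e) \<le> e 0) * w (e 0 mod M) * of_nat (e 0) ^ k"
  shows "separated_fun D f"
  using separated_fun_cong[OF separated_fun.base[OF assms(1-3)] assms(5)[symmetric]] assms(4) by simp

text \<open>The product of two basic terms is a basic term: the thresholds combine to their maximum,
  the moduli to their product, and the degrees add up. Distributivity does the rest.\<close>

lemma separated_fun_mult:
  assumes "separated_fun d f" "separated_fun d' g"
  shows "separated_fun (d + d') (\<lambda>e. f e * g e)"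
  using assms(1)
proof (induction rule: separated_fun.induct)
  case (base \<tau> M d h k w)
  from assms(2) show ?case
  proof (induction rule: separated_fun.induct)
    case (base \<tau>' M' d' h' k' w')
    show ?case
    proof (rule separated_fun_base)
      show "threshold (\<lambda>e. max (\<tau> e) (\<tau>' e))"
        by (rule threshold_max[OF \<open>threshold \<tau>\<close> \<open>threshold \<tau>'\<close>])
      show "0 < M * M'" using \<open>0 < M\<close> \<open>0 < M'\<close> by simp
      show "pwpoly (d + d') (\<lambda>e. h e * h' e)"
        by (rule pwpoly.mult[OF \<open>pwpoly d h\<close> \<open>pwpoly d' h'\<close>])
      show "d + k + (d' + k') = d + d' + (k + k')" by simp
      fix e
      show "h (tail e) * of_bool (\<tau> (tail e) \<le> e 0) * w (e 0 mod M) * of_nat (e 0) ^ k *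
         (h' (tail e) * of_bool (\<tau>' (tail e) \<le> e 0) * w' (e 0 mod M') * of_nat (e 0) ^ k') =
         h (tail e) * h' (tail e) * of_bool (max (\<tau> (tail e)) (\<tau>' (tail e)) \<le> e 0) *
         (\<lambda>s. w (s mod M) * w' (s mod M')) (e 0 mod (M * M')) * of_nat (e 0) ^ (k + k')"
        by (simp add: power_add mod_mod_cancel)
    qed
  next
    case (add d' f g)
    then show ?case by (simp only: distrib_left) (rule separated_fun.add)
  qed
next
  case (add d f g)
  then show ?case by (simp only: distrib_right) (rule separated_fun.add)
qed

lemma separated_fun_tail: "pwpoly d h \<Longrightarrow> separated_fun d (\<lambda>e. h (tail e))"
  by (rule separated_fun_base[where \<tau> = "\<lambda>_. 0" and M = 1 and h = h and k = 0 and w = "\<lambda>_. 1"])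
    (auto intro: threshold_const)

text \<open>Basic terms contain only lower bounds on the first variable. Negations, and with them
  upper bounds, are expressed as 1 minus an indicator, a sum of basic terms.\<close>

lemma separated_fun_indicator:
  assumes "separated A"
  shows "separated_fun 0 (\<lambda>e. of_bool (A e))"
  using assms
proof (induction rule: separated.induct)
  case (threshold \<tau>)
  show ?case
    by (rule separated_fun_base[where \<tau> = \<tau> and M = 1 and h = "\<lambda>_. 1" and k = 0 and w = "\<lambda>_. 1"])
      (auto intro: threshold pwpoly.const)
next
  case (mod M r)
  show ?case
    by (rule separated_fun_base[where \<tau> = "\<lambda>_. 0" and M = M and h = "\<lambda>_. 1" and k = 0
          and w = "\<lambda>s. of_bool (s = r)"])
      (auto intro: mod threshold_const pwpoly.const)
next
  case (tail A)
  then show ?case by (rule separated_fun_tail[OF pwpoly.indicator])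
next
  case (neg A)
  have "separated_fun 0 (\<lambda>e. 1 + (- 1) * of_bool (A e))"
    using separated_fun.add[OF separated_fun_tail[OF pwpoly.const[of 0 1]]
        separated_fun_mult[OF separated_fun_tail[OF pwpoly.const[of 0 "-1"]] neg.IH, simplified add_0]] .
  then show ?case by (rule separated_fun_cong) simp
next
  case (conj A B)
  have "separated_fun 0 (\<lambda>e. of_bool (A e) * of_bool (B e))"
    using separated_fun_mult[OF conj.IH] by simp
  then show ?case by (rule separated_fun_cong) simp
qed

lemma separated_fun_mono:
  assumes "separated_fun d f" "d \<le> d'"
  shows "separated_fun d' f"
  using separated_fun_mult[OF assms(1) separated_fun_tail[OF pwpoly.const[of "d' - d" 1]]] assms(2) by simp

lemma pwpoly_imp_separated_fun:
  assumes "pwpoly d f"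
  shows "separated_fun d f"
  using assms
proof (induction rule: pwpoly.induct)
  case (const d c)
  show ?case by (rule separated_fun_tail[OF pwpoly.const])
next
  case (var d i)
  show ?case
  proof (cases i)
    case 0
    then show ?thesis
      by (intro separated_fun_base[where \<tau> = "\<lambda>_. 0" and M = 1 and h = "\<lambda>_. 1" and d = d and k = 1
            and w = "\<lambda>_. 1"]) (auto intro: threshold_const pwpoly.const)
  next
    case (Suc j)
    then show ?thesis using separated_fun_tail[OF pwpoly.var[of d j]] by simp
  qed
next
  case (indicator A d)
  then show ?case using separated_fun_mono[OF separated_fun_indicator[OF presb_imp_separated]] by simp
next
  case (add d f g)
  then show ?case by (intro separated_fun.add)
next
  case (mult d f d' g)
  then show ?case by (intro separated_fun_mult)
qed

lemma separated_fun_sum: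
  assumes "separated_fun d f" "threshold \<sigma>"
  shows "pwpoly (Suc d) (\<lambda>e. \<Sum>y<\<sigma> e. f (case_nat y e))"
  using assms(1)
proof (induction rule: separated_fun.induct)
  case (base \<tau> M d h k w)
  let ?F = "\<lambda>Y. \<Sum>y<Y. w (y mod M) * of_nat y ^ k"
  have "threshold (\<lambda>e. max (\<tau> e) (\<sigma> e))" by (rule threshold_max[OF base(1) assms(2)])
  \<comment> \<open>The sum runs from \<open>\<tau> e\<close> to below \<open>\<sigma> e\<close>.
    The maximum makes the difference vanish when this range is empty.\<close>
  then have "pwpoly (d + Suc k) (\<lambda>e. h e * (?F (max (\<tau> e) (\<sigma> e)) - ?F (\<tau> e)))"
    by (intro pwpoly.mult pwpoly_diff base(3) pwpoly_power_sum base(1,2))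
  then have "pwpoly (Suc (d + k)) (\<lambda>e. h e * (?F (max (\<tau> e) (\<sigma> e)) - ?F (\<tau> e)))"
    by simp
  then show ?case
  proof (rule pwpoly_cong)
    fix e
    let ?g = "\<lambda>y. w (y mod M) * of_nat y ^ k"
    have "?F (max (\<tau> e) (\<sigma> e)) - ?F (\<tau> e) = sum ?g {\<tau> e..<max (\<tau> e) (\<sigma> e)}"
      by (simp add: sum_diff_nat_ivl lessThan_atLeast0 sum_diff_nat_ivl)
    also have "\<dots> = (\<Sum>y<\<sigma> e. of_bool (\<tau> e \<le> y) * ?g y)"
      by (rule sum.mono_neutral_cong_left) auto
    finally have eq: "?F (max (\<tau> e) (\<sigma> e)) - ?F (\<tau> e) = (\<Sum>y<\<sigma> e. of_bool (\<tau> e \<le> y) * ?g y)" .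
    show "h e * (?F (max (\<tau> e) (\<sigma> e)) - ?F (\<tau> e)) = (\<Sum>y<\<sigma> e. h (tail (case_nat y e)) *
        of_bool (\<tau> (tail (case_nat y e)) \<le> case_nat y e 0) * w (case_nat y e 0 mod M) *
        of_nat (case_nat y e 0) ^ k)"
      unfolding eq sum_distrib_left by (rule sum.cong) simp_all
  qed
next
  case (add d f g)
  then show ?case by (simp only: sum.distrib) (rule pwpoly.add)
qed

text \<open>Above all thresholds every step factor is 1, and on a residue class every periodic
  factor is constant. The polynomials may depend on e in any way, because only the finiteness of
  their root sets will be used; the bound and the modulus are what must be uniform.\<close>

lemma separated_fun_eventually_polynomial:
  assumes "separated_fun d f"
  shows "\<exists>\<tau> M. threshold \<tau> \<and> 0 < M \<and>
    (\<forall>e. \<exists>p. \<forall>y\<ge>\<tau> e. f (case_nat y e) = poly (p (y mod M)) (of_nat y))"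
  using assms
proof (induction rule: separated_fun.induct)
  case (base \<tau> M d h k w)
  have "\<exists>p. \<forall>y\<ge>\<tau> e. h e * w (y mod M) * of_nat y ^ k = poly (p (y mod M)) (of_nat y)" for e
    by (rule exI[of _ "\<lambda>s. Polynomial.smult (h e * w s) (Polynomial.monom 1 k)"]) (simp add: poly_monom)
  then show ?case
    using base by (intro exI[of _ \<tau>] exI[of _ M]) simp
next
  case (add d f g)
  then obtain \<tau> M \<tau>' M' where *: "threshold \<tau>" "0 < M" "threshold \<tau>'" "0 < M'"
    "\<forall>e. \<exists>p. \<forall>y\<ge>\<tau> e. f (case_nat y e) = poly (p (y mod M)) (of_nat y)"
    "\<forall>e. \<exists>p. \<forall>y\<ge>\<tau>' e. g (case_nat y e) = poly (p (y mod M')) (of_nat y)"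
    by (elim exE conjE)
  have "\<exists>p. \<forall>y\<ge>max (\<tau> e) (\<tau>' e). f (case_nat y e) + g (case_nat y e)
      = poly (p (y mod (M * M'))) (of_nat y)" for e
  proof -
    obtain p where p: "\<forall>y\<ge>\<tau> e. f (case_nat y e) = poly (p (y mod M)) (of_nat y)"
      using *(5) by blast
    obtain q where q: "\<forall>y\<ge>\<tau>' e. g (case_nat y e) = poly (q (y mod M')) (of_nat y)"
      using *(6) by blast
    show ?thesis
      by (rule exI[of _ "\<lambda>s. p (s mod M) + q (s mod M')"])
        (simp add: p[rule_format] q[rule_format] mod_mod_cancel)
  qed
  then show ?case
    using * by (intro exI[of _ "\<lambda>e. max (\<tau> e) (\<tau>' e)"] exI[of _ "M * M'"]) (auto intro: threshold_max)
qed

text \<open>A function of finite support in y that is eventually polynomial on residue classes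
  vanishes beyond its threshold. The sum over the support, whose size is not controlled a priori, is
  thus a sum up to a threshold.\<close>

lemma pwpoly_finite_sum:
  assumes f: "pwpoly d f" and fin: "\<And>e. finite {y. f (case_nat y e) \<noteq> 0}"
  shows "pwpoly (Suc d) (\<lambda>e. \<Sum>y | f (case_nat y e) \<noteq> 0. f (case_nat y e))"
proof -
  have s: "separated_fun d f" by (rule pwpoly_imp_separated_fun[OF f])
  obtain \<tau> M where \<tau>: "threshold \<tau>" and M: "0 < M"
    and ev: "\<forall>e. \<exists>p. \<forall>y\<ge>\<tau> e. f (case_nat y e) = poly (p (y mod M)) (of_nat y)"
    using separated_fun_eventually_polynomial[OF s] by blast
  have zero: "f (case_nat y e) = 0" if "\<tau> e \<le> y" for y e
  proof (rule ccontr)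
    assume nz: "f (case_nat y e) \<noteq> 0"
    obtain p where p: "\<And>y. \<tau> e \<le> y \<Longrightarrow> f (case_nat y e) = poly (p (y mod M)) (of_nat y)"
      using ev by blast
    let ?q = "p (y mod M)"
    have "?q \<noteq> 0" using p[OF that] nz by auto
    then have "finite {x. poly ?q x = 0}" by (rule poly_roots_finite)
    \<comment> \<open>Along y, y + M, y + 2M, ... the same nonzero polynomial is evaluated. Only
      finitely many j give a root, and by the finite support only finitely many give no root,
      although there are infinitely many j.\<close>
    then have "finite ((\<lambda>j. of_nat (y + j * M) :: rat) -` {x. poly ?q x = 0})"
      using M by (intro finite_vimageI) (auto simp: inj_def)
    moreover have "finite ((\<lambda>j. y + j * M) -` {y. f (case_nat y e) \<noteq> 0})"
      using M by (intro finite_vimageI fin) (auto simp: inj_def)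
    moreover have "(\<lambda>j. of_nat (y + j * M) :: rat) -` {x. poly ?q x = 0} \<union>
        (\<lambda>j. y + j * M) -` {y. f (case_nat y e) \<noteq> 0} = UNIV"
      using p that by (auto simp: trans_le_add1)
    ultimately show False by (metis finite_Un infinite_UNIV_nat)
  qed
  have eq: "(\<Sum>y<\<tau> e. f (case_nat y e)) = (\<Sum>y | f (case_nat y e) \<noteq> 0. f (case_nat y e))" for e
    using zero[of e] by (intro sum.mono_neutral_right) (auto simp: not_le[symmetric])
  show ?thesis by (rule pwpoly_cong[OF separated_fun_sum[OF s \<tau>]]) (rule eq)
qed

text \<open>The last entry of a list is the one placed directly in front of \<open>e\<close>.
  Splitting it off leaves the count for shorter lists over \<open>case_nat z e\<close>, so that the
  cardinality becomes an iterated sum over single variables.\<close>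

lemma pwpoly_card:
  assumes A: "presb A" and fin: "\<And>e. finite {ys. length ys = k \<and> A (foldr case_nat ys e)}"
  shows "pwpoly k (\<lambda>e. of_nat (card {ys. length ys = k \<and> A (foldr case_nat ys e)}))"
  using fin
proof (induction k)
  case 0
  have eq: "of_bool (A e) = (of_nat (card {ys. length ys = 0 \<and> A (foldr case_nat ys e)}) :: rat)" for e
  proof -
    have "{ys :: nat list. length ys = 0 \<and> A (foldr case_nat ys e)} = (if A e then {[]} else {})"
      by auto
    then show ?thesis by simp
  qed
  show ?case by (rule pwpoly_cong[OF pwpoly.indicator[OF A]]) (rule eq)
next
  case (Suc k)
  let ?S = "\<lambda>k e. {ys. length ys = k \<and> A (foldr case_nat ys e)}"
  have S: "?S (Suc k) e = (\<Union>z. (\<lambda>ys. ys @ [z]) ` ?S k (case_nat z e))" for e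
  proof (rule equalityI; rule subsetI)
    fix xs assume xs: "xs \<in> ?S (Suc k) e"
    then obtain ys z where "xs = ys @ [z]"
      by (cases xs rule: rev_cases) auto
    then show "xs \<in> (\<Union>z. (\<lambda>ys. ys @ [z]) ` ?S k (case_nat z e))"
      using xs by auto
  qed auto
  have inj: "inj_on (\<lambda>ys. ys @ [z]) X" for z :: nat and X by (auto simp: inj_on_def)
  \<comment> \<open>Every environment is \<open>case_nat (e 0) (tail e)\<close>, so the set for k at
    \<open>e\<close> embeds into the set for k + 1 at \<open>tail e\<close>. This is why finiteness
    is assumed at all environments.\<close>
  have fin: "finite (?S k e)" for e
  proof -
    have "(\<lambda>ys. ys @ [e 0]) ` ?S k e \<subseteq> ?S (Suc k) (tail e)"
      unfolding S[of "tail e"] using case_nat_tail[of e] by force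
    then show ?thesis
      using Suc.prems[of "tail e"] inj by (meson finite_imageD finite_subset)
  qed
  let ?f = "\<lambda>e. of_nat (card (?S k e)) :: rat"
  have supp: "finite {z. ?f (case_nat z e) \<noteq> 0}" for e
  proof (rule finite_subset)
    show "{z. ?f (case_nat z e) \<noteq> 0} \<subseteq> last ` ?S (Suc k) e"
    proof
      fix z assume "z \<in> {z. ?f (case_nat z e) \<noteq> 0}"
      then have "?S k (case_nat z e) \<noteq> {}" by (metis (mono_tags) card.empty mem_Collect_eq of_nat_0)
      then obtain ys where "ys \<in> ?S k (case_nat z e)" by blast
      then have "ys @ [z] \<in> ?S (Suc k) e" unfolding S by blast
      then show "z \<in> last ` ?S (Suc k) e" by (rule rev_image_eqI) simp
    qed
    show "finite (last ` ?S (Suc k) e)" by (rule finite_imageI[OF Suc.prems])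
  qed
  have eq: "(\<Sum>z | ?f (case_nat z e) \<noteq> 0. ?f (case_nat z e)) = of_nat (card (?S (Suc k) e))" for e
  proof -
    let ?Z = "{z. ?f (case_nat z e) \<noteq> 0}"
    have "?S (Suc k) e = (\<Union>z\<in>?Z. (\<lambda>ys. ys @ [z]) ` ?S k (case_nat z e))"
      unfolding S using fin by (auto simp: card_eq_0_iff)
    then have "card (?S (Suc k) e) = (\<Sum>z\<in>?Z. card ((\<lambda>ys. ys @ [z]) ` ?S k (case_nat z e)))"
      using supp[of e] fin by (simp only:) (rule card_UN_disjoint, auto)
    also have "\<dots> = (\<Sum>z\<in>?Z. card (?S k (case_nat z e)))"
      by (simp add: card_image[OF inj])
    finally show ?thesis by simp
  qed
  show ?case by (rule pwpoly_cong[OF pwpoly_finite_sum[OF Suc.IH[OF fin] supp]]) (rule eq)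
qed

section \<open>Decomposition of Presburger sets into lattices\<close>

text \<open>For finite \<open>P\<close>, the nonempty cells are the atoms of the Boolean algebra
  generated by \<open>P\<close>. The pattern \<open>V\<close> may contain predicates outside
  \<open>P\<close>, so that a cell of a union of two sets lies in the cells of both sets with the
  same \<open>V\<close>.\<close>

definition cell :: "(env \<Rightarrow> bool) set \<Rightarrow> (env \<Rightarrow> bool) set \<Rightarrow> env \<Rightarrow> bool" where
  "cell P V e \<longleftrightarrow> (\<forall>A\<in>P. A e \<longleftrightarrow> A \<in> V)"

lemma presb_cell:
  assumes "finite P" "\<forall>A\<in>P. presb A"
  shows "presb (cell P V)"
proof -
  have "presb (\<lambda>e. A e \<longleftrightarrow> b)" if "A \<in> P" for A b
    using assms(2) that by (cases b) (auto intro: presb.neg)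
  then have "presb (\<lambda>e. \<forall>A\<in>P. A e \<longleftrightarrow> A \<in> V)"
    by (intro presb_Ball assms(1))
  then show ?thesis by (rule presb_cong) (simp add: cell_def)
qed

lemma ex1_cell: "\<exists>!V. V \<in> Pow P \<and> cell P V e"
  by (rule ex1I[of _ "{A \<in> P. A e}"]) (auto simp: cell_def)

inductive polyfun :: "nat \<Rightarrow> (env \<Rightarrow> rat) \<Rightarrow> bool" where
  const: "polyfun d (\<lambda>_. c)"
| var: "polyfun (Suc d) (\<lambda>e. of_nat (e i))"
| add: "polyfun d f \<Longrightarrow> polyfun d g \<Longrightarrow> polyfun d (\<lambda>e. f e + g e)"
| mult: "polyfun d f \<Longrightarrow> polyfun d' g \<Longrightarrow> polyfun (d + d') (\<lambda>e. f e * g e)"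

text \<open>\<open>P\<close> collects the predicates whose indicators enter into f. On a cell each
  of these indicators is constant, and replacing it by its value leaves a polynomial of the same
  degree bound.\<close>

lemma pwpoly_pieces:
  assumes "pwpoly d f"
  shows "\<exists>P. finite P \<and> (\<forall>A\<in>P. presb A) \<and>
    (\<forall>V. \<exists>p. polyfun d p \<and> (\<forall>e. cell P V e \<longrightarrow> f e = p e))"
  using assms
proof (induction rule: pwpoly.induct)
  case (const d c)
  show ?case by (rule exI[of _ "{}"]) (auto intro: polyfun.const)
next
  case (var d i)
  show ?case by (rule exI[of _ "{}"]) (auto intro: polyfun.var)
next
  case (indicator A d)
  have "\<exists>p. polyfun d p \<and> (\<forall>e. cell {A} V e \<longrightarrow> of_bool (A e) = p e)" for V
    by (rule exI[of _ "\<lambda>_. of_bool (A \<in> V)"]) (auto intro: polyfun.const simp: cell_def)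
  then show ?case using indicator by (intro exI[of _ "{A}"]) auto
next
  case (add d f g)
  then obtain P Q where *: "finite P" "\<forall>A\<in>P. presb A" "finite Q" "\<forall>A\<in>Q. presb A"
    "\<forall>V. \<exists>p. polyfun d p \<and> (\<forall>e. cell P V e \<longrightarrow> f e = p e)"
    "\<forall>V. \<exists>p. polyfun d p \<and> (\<forall>e. cell Q V e \<longrightarrow> g e = p e)"
    by (elim exE conjE)
  have "\<exists>p. polyfun d p \<and> (\<forall>e. cell (P \<union> Q) V e \<longrightarrow> f e + g e = p e)" for V
  proof -
    obtain p q where "polyfun d p" "\<forall>e. cell P V e \<longrightarrow> f e = p e"
      "polyfun d q" "\<forall>e. cell Q V e \<longrightarrow> g e = q e" using *(5,6) by meson
    then show ?thesis
      by (intro exI[of _ "\<lambda>e. p e + q e"]) (auto simp: cell_def intro: polyfun.add)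
  qed
  then show ?case using * by (intro exI[of _ "P \<union> Q"]) auto
next
  case (mult d f d' g)
  then obtain P Q where *: "finite P" "\<forall>A\<in>P. presb A" "finite Q" "\<forall>A\<in>Q. presb A"
    "\<forall>V. \<exists>p. polyfun d p \<and> (\<forall>e. cell P V e \<longrightarrow> f e = p e)"
    "\<forall>V. \<exists>p. polyfun d' p \<and> (\<forall>e. cell Q V e \<longrightarrow> g e = p e)"
    by (elim exE conjE)
  have "\<exists>p. polyfun (d + d') p \<and> (\<forall>e. cell (P \<union> Q) V e \<longrightarrow> f e * g e = p e)" for V
  proof -
    obtain p q where "polyfun d p" "\<forall>e. cell P V e \<longrightarrow> f e = p e"
      "polyfun d' q" "\<forall>e. cell Q V e \<longrightarrow> g e = q e" using *(5,6) by meson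
    then show ?thesis
      by (intro exI[of _ "\<lambda>e. p e * q e"]) (auto simp: cell_def intro: polyfun.mult)
  qed
  then show ?case using * by (intro exI[of _ "P \<union> Q"]) auto
qed

section \<open>Affine functions and affine maps on N^s\<close>

definition Nvec :: "nat \<Rightarrow> env set" where
  "Nvec s = {e. \<forall>i\<ge>s. e i = 0}"

lemma tail_Nvec: "e \<in> Nvec (Suc s) \<Longrightarrow> tail e \<in> Nvec s"
  by (simp add: Nvec_def)

lemma case_nat_Nvec: "e \<in> Nvec s \<Longrightarrow> case_nat y e \<in> Nvec (Suc s)"
  by (auto simp: Nvec_def split: nat.split)

definition affine_on :: "nat \<Rightarrow> (env \<Rightarrow> 'a :: comm_semiring_1) \<Rightarrow> bool" where
  "affine_on s g \<longleftrightarrow> (\<exists>c a. \<forall>k\<in>Nvec s. g k = c + (\<Sum>i<s. a i * of_nat (k i)))"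

lemma affine_on_cong: "(\<And>k. k \<in> Nvec s \<Longrightarrow> f k = g k) \<Longrightarrow> affine_on s f \<longleftrightarrow> affine_on s g"
  by (simp add: affine_on_def)

lemma affine_on_const: "affine_on s (\<lambda>_. c)"
  unfolding affine_on_def by (rule exI[of _ c], rule exI[of _ "\<lambda>_. 0"]) simp

lemma affine_on_var: "affine_on s (\<lambda>k. of_nat (k i))"
proof -
  have "of_nat (k i) = 0 + (\<Sum>j<s. (if j = i then 1 else 0) * of_nat (k j) :: 'a)" if "k \<in> Nvec s" for k
  proof -
    have "(\<Sum>j<s. (if j = i then 1 else 0) * of_nat (k j) :: 'a) = (\<Sum>j<s. if j = i then of_nat (k j) else 0)"
      by (rule sum.cong) auto
    also have "\<dots> = of_nat (k i)" using that by (subst sum.delta) (auto simp: Nvec_def)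
    finally show ?thesis by simp
  qed
  then show ?thesis
    unfolding affine_on_def
    by (intro exI[of _ 0] exI[of _ "\<lambda>j. if j = i then 1 else 0"]) blast
qed

lemma affine_on_var_nat: "affine_on s (\<lambda>k. k i)"
  using affine_on_var[of s i, where 'a = nat] by simp

lemma affine_on_add:
  assumes "affine_on s f" "affine_on s g"
  shows "affine_on s (\<lambda>k. f k + g k)"
proof -
  obtain c a c' a' where "\<forall>k\<in>Nvec s. f k = c + (\<Sum>i<s. a i * of_nat (k i))"
    "\<forall>k\<in>Nvec s. g k = c' + (\<Sum>i<s. a' i * of_nat (k i))"
    using assms unfolding affine_on_def by blast
  then show ?thesis
    unfolding affine_on_def
    by (intro exI[of _ "c + c'"] exI[of _ "\<lambda>i. a i + a' i"])
      (simp add: sum.distrib distrib_right add.assoc add.left_commute)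
qed

lemma affine_on_if:
  "affine_on s f \<Longrightarrow> affine_on s g \<Longrightarrow> affine_on s (\<lambda>k. if b then f k else g k)"
  by (cases b) simp_all

lemma affine_on_scale:
  assumes "affine_on s f"
  shows "affine_on s (\<lambda>k. b * f k)"
proof -
  obtain c a where "\<forall>k\<in>Nvec s. f k = c + (\<Sum>i<s. a i * of_nat (k i))"
    using assms unfolding affine_on_def by blast
  then show ?thesis
    unfolding affine_on_def
    by (intro exI[of _ "b * c"] exI[of _ "\<lambda>i. b * a i"])
      (simp add: sum_distrib_left distrib_left mult.assoc)
qed

lemma affine_on_sum:
  "finite I \<Longrightarrow> (\<And>i. i \<in> I \<Longrightarrow> affine_on s (f i)) \<Longrightarrow> affine_on s (\<lambda>k. \<Sum>i\<in>I. f i k)"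
  by (induction I rule: finite_induct) (auto intro: affine_on_const affine_on_add)

lemma affine_on_of_nat:
  assumes "affine_on s f"
  shows "affine_on s (\<lambda>k. of_nat (f k))"
proof -
  obtain c a where "\<forall>k\<in>Nvec s. f k = c + (\<Sum>i<s. a i * k i)"
    using assms unfolding affine_on_def by auto
  then show ?thesis
    unfolding affine_on_def
    by (intro exI[of _ "of_nat c"] exI[of _ "\<lambda>i. of_nat (a i)"]) simp
qed

text \<open>The constant is the value at 0, and each coefficient is the difference between the
  values at a unit vector and at 0, hence an integer. A negative coefficient would make the function
  negative far out along that axis. Natural coefficients are what the subdivision of the region
  below a graph requires.\<close>

lemma affine_on_nat:
  fixes f :: "env \<Rightarrow> nat"
  assumes "affine_on s (\<lambda>k. of_nat (f k) :: rat)"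
  shows "affine_on s f"
proof -
  obtain c :: rat and a where f: "\<And>k. k \<in> Nvec s \<Longrightarrow> of_nat (f k) = c + (\<Sum>i<s. a i * of_nat (k i))"
    using assms unfolding affine_on_def by blast
  define u :: "nat \<Rightarrow> nat \<Rightarrow> env" where "u j i = (\<lambda>l. if l = i then j else 0)" for i j
  have c: "c = of_nat (f (\<lambda>_. 0))" using f[of "\<lambda>_. 0"] by (simp add: Nvec_def)
  have u: "of_nat (f (u j i)) = c + a i * of_nat j" if "i < s" for i j
  proof -
    have "(\<Sum>l<s. a l * of_nat (u j i l)) = (\<Sum>l<s. if l = i then a l * of_nat j else 0)"
      by (rule sum.cong) (auto simp: u_def)
    also have "\<dots> = a i * of_nat j" using that by (subst sum.delta) auto
    finally show ?thesis using f[of "u j i"] that by (auto simp: u_def Nvec_def)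
  qed
  have nonneg: "0 \<le> a i" if "i < s" for i
  proof (rule ccontr)
    assume "\<not> 0 \<le> a i"
    then have neg: "a i < 0" by simp
    obtain j :: nat where "c / - a i < of_nat j" using reals_Archimedean2 by blast
    then have "c + a i * of_nat j < 0" using neg by (simp add: field_simps)
    then show False using u[OF that, of j] by (metis not_less of_nat_0_le_iff)
  qed
  have "a i = of_nat (f (u 1 i) - f (\<lambda>_. 0))" if "i < s" for i
  proof -
    have "of_nat (f (u 1 i)) = of_nat (f (\<lambda>_. 0)) + a i" using u[OF that, of 1] c by simp
    moreover from this have "f (\<lambda>_. 0) \<le> f (u 1 i)"
      using nonneg[OF that] by (metis le_add_same_cancel1 of_nat_le_iff)
    ultimately show ?thesis by (simp add: of_nat_diff)
  qed
  then have "(of_nat (f k) :: rat) = of_nat (f (\<lambda>_. 0) + (\<Sum>i<s. (f (u 1 i) - f (\<lambda>_. 0)) * k i))"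
    if "k \<in> Nvec s" for k
    using f[OF that] c by simp
  then have "f k = f (\<lambda>_. 0) + (\<Sum>i<s. (f (u 1 i) - f (\<lambda>_. 0)) * of_nat (k i))"
    if "k \<in> Nvec s" for k
    using that unfolding of_nat_eq_iff by simp
  then show ?thesis
    unfolding affine_on_def
    by (intro exI[of _ "f (\<lambda>_. 0)"] exI[of _ "\<lambda>i. f (u 1 i) - f (\<lambda>_. 0)"]) blast
qed

definition affine_map :: "nat \<Rightarrow> nat \<Rightarrow> (env \<Rightarrow> env) \<Rightarrow> bool" where
  "affine_map s m \<Phi> \<longleftrightarrow> \<Phi> \<in> Nvec s \<rightarrow> Nvec m \<and> (\<forall>i. affine_on s (\<lambda>k. \<Phi> k i))"

lemma affine_on_compose:
  assumes "affine_on m g" "affine_map s m \<Phi>"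
  shows "affine_on s (\<lambda>k. g (\<Phi> k))"
proof -
  obtain c a where g: "\<forall>k\<in>Nvec m. g k = c + (\<Sum>i<m. a i * of_nat (k i))"
    using assms(1) unfolding affine_on_def by blast
  have "affine_on s (\<lambda>k. c + (\<Sum>i<m. a i * of_nat (\<Phi> k i)))"
    by (intro affine_on_add affine_on_const affine_on_sum affine_on_scale affine_on_of_nat)
      (use assms(2) in \<open>auto simp: affine_map_def\<close>)
  then show ?thesis
    using g assms(2) by (subst affine_on_cong) (auto simp: affine_map_def)
qed

lemma affine_map_compose:
  assumes "affine_map s m \<Phi>" "affine_map m l \<Psi>"
  shows "affine_map s l (\<lambda>k. \<Psi> (\<Phi> k))"
proof -
  have "affine_on s (\<lambda>k. \<Psi> (\<Phi> k) i)" for i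
    by (rule affine_on_compose[of m "\<lambda>e. \<Psi> e i", OF _ assms(1)]) (use assms(2) in \<open>simp add: affine_map_def\<close>)
  then show ?thesis using assms by (auto simp: affine_map_def)
qed

lemma affine_map_tail: "affine_map (Suc s) s tail"
  by (auto simp: affine_map_def tail_Nvec affine_on_var_nat)

lemma affine_map_case_nat:
  assumes "affine_on s g" "affine_map s m \<Phi>"
  shows "affine_map s (Suc m) (\<lambda>k. case_nat (g k) (\<Phi> k))"
proof -
  have "affine_on s (\<lambda>k. case_nat (g k) (\<Phi> k) i)" for i
    using assms by (cases i) (auto simp: affine_map_def)
  then show ?thesis
    using assms(2) unfolding affine_map_def by (auto intro!: case_nat_Nvec)
qed

text \<open>In a product of total degree at most 1 one factor has index 0 and is therefore constant
  along \<open>\<Phi>\<close>. The induction needs the statement about index 0 for this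
  reason.\<close>

lemma polyfun_affine:
  assumes "polyfun d p" "affine_map s m \<Phi>"
  shows "(d = 0 \<longrightarrow> (\<exists>c. \<forall>k\<in>Nvec s. p (\<Phi> k) = c)) \<and> (d \<le> 1 \<longrightarrow> affine_on s (\<lambda>k. p (\<Phi> k)))"
  using assms(1)
proof (induction rule: polyfun.induct)
  case (const d c)
  then show ?case by (simp add: affine_on_const)
next
  case (var d i)
  then show ?case using assms(2) by (simp add: affine_map_def affine_on_of_nat)
next
  case (add d f g)
  then show ?case by (auto intro: affine_on_add)
next
  case (mult d f d' g)
  have const: "affine_on s (\<lambda>k. f (\<Phi> k) * g (\<Phi> k))"
    if "\<forall>k\<in>Nvec s. f (\<Phi> k) = c" "affine_on s (\<lambda>k. g (\<Phi> k))" for f g c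
    using affine_on_scale[OF that(2), of c] that(1) by (subst affine_on_cong) auto
  have "affine_on s (\<lambda>k. f (\<Phi> k) * g (\<Phi> k))" if "d + d' \<le> 1"
  proof (cases "d = 0")
    case True
    then show ?thesis using mult.IH that const[of f _ g] by auto
  next
    case False
    then show ?thesis using mult.IH that const[of g _ f] by (auto simp: mult.commute)
  qed
  then show ?case using mult.IH by auto
qed

text \<open>These are fundamental lattices in parametric form: the columns of coefficients of
  \<open>\<Phi>\<close> are the periods, and injectivity on \<open>Nvec s\<close> stands for their
  linear independence. The form is stable under composition with injective affine maps.\<close>

definition affine_lattice :: "nat \<Rightarrow> env set \<Rightarrow> bool" where
  "affine_lattice m C \<longleftrightarrow> (\<exists>s \<Phi>. affine_map s m \<Phi> \<and> inj_on \<Phi> (Nvec s) \<and> C = \<Phi> ` Nvec s)"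

definition lattice_union :: "nat \<Rightarrow> env set \<Rightarrow> bool" where
  "lattice_union m D \<longleftrightarrow> (\<exists>\<C>. finite \<C> \<and> disjoint \<C> \<and> (\<forall>C\<in>\<C>. affine_lattice m C) \<and> \<Union>\<C> = D)"

lemma affine_lattice_subset: "affine_lattice m C \<Longrightarrow> C \<subseteq> Nvec m"
  by (auto simp: affine_lattice_def affine_map_def)

lemma lattice_union_empty: "lattice_union m {}"
  unfolding lattice_union_def by (rule exI[of _ "{}"]) auto

lemma lattice_union_affine_lattice: "affine_lattice m C \<Longrightarrow> lattice_union m C"
  unfolding lattice_union_def by (rule exI[of _ "{C}"]) auto

lemma lattice_union_Un:
  assumes "lattice_union m X" "lattice_union m Y" "X \<inter> Y = {}"
  shows "lattice_union m (X \<union> Y)"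
proof -
  obtain \<C> \<D> where "finite \<C>" "disjoint \<C>" "\<forall>C\<in>\<C>. affine_lattice m C" "\<Union>\<C> = X"
    "finite \<D>" "disjoint \<D>" "\<forall>C\<in>\<D>. affine_lattice m C" "\<Union>\<D> = Y"
    using assms(1,2) unfolding lattice_union_def by blast
  then show ?thesis
    unfolding lattice_union_def using assms(3)
    by (intro exI[of _ "\<C> \<union> \<D>"]) (auto intro!: disjoint_union)
qed

lemma lattice_union_UN:
  "finite I \<Longrightarrow> (\<And>i. i \<in> I \<Longrightarrow> lattice_union m (X i)) \<Longrightarrow> disjoint_family_on X I \<Longrightarrow>
    lattice_union m (\<Union>i\<in>I. X i)"
proof (induction I rule: finite_induct)
  case empty
  then show ?case by (simp add: lattice_union_empty)
next
  case (insert i I)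
  have "lattice_union m (\<Union>j\<in>I. X j)"
  proof (rule insert.IH)
    show "disjoint_family_on X I" using insert.prems(2) by (simp add: disjoint_family_on_def)
    show "lattice_union m (X j)" if "j \<in> I" for j using insert.prems(1)[of j] that by simp
  qed
  moreover have "X i \<inter> X j = {}" if "j \<in> I" for j
    using insert.hyps(2) that by (intro disjoint_family_onD[OF insert.prems(2)]) auto
  then have "X i \<inter> (\<Union>j\<in>I. X j) = {}" by blast
  ultimately show ?case using lattice_union_Un[OF insert.prems(1)[of i]] by simp
qed

lemma affine_lattice_image:
  assumes "affine_lattice s C" "affine_map s m \<Phi>" "inj_on \<Phi> (Nvec s)"
  shows "affine_lattice m (\<Phi> ` C)"
proof -
  obtain r \<Psi> where \<Psi>: "affine_map r s \<Psi>" "inj_on \<Psi> (Nvec r)" "C = \<Psi> ` Nvec r"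
    using assms(1) unfolding affine_lattice_def by blast
  have "inj_on (\<lambda>k. \<Phi> (\<Psi> k)) (Nvec r)"
    using \<Psi> assms(3) by (auto simp: inj_on_def affine_map_def Pi_iff)
  then show ?thesis
    unfolding affine_lattice_def using affine_map_compose[OF \<Psi>(1) assms(2)] \<Psi>(3)
    by (intro exI[of _ r] exI[of _ "\<lambda>k. \<Phi> (\<Psi> k)"]) (simp add: image_image)
qed

lemma lattice_union_image:
  assumes "lattice_union s X" "affine_map s m \<Phi>" "inj_on \<Phi> (Nvec s)"
  shows "lattice_union m (\<Phi> ` X)"
proof -
  obtain \<C> where \<C>: "finite \<C>" "disjoint \<C>" "\<forall>C\<in>\<C>. affine_lattice s C" "\<Union>\<C> = X"
    using assms(1) unfolding lattice_union_def by blast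
  have "lattice_union m (\<Union>C\<in>\<C>. \<Phi> ` C)"
  proof (rule lattice_union_UN[OF \<C>(1)])
    show "lattice_union m (\<Phi> ` C)" if "C \<in> \<C>" for C
      using lattice_union_affine_lattice[OF affine_lattice_image[OF _ assms(2,3)]] \<C>(3) that by blast
    show "disjoint_family_on ((`) \<Phi>) \<C>"
    proof (unfold disjoint_family_on_def, intro ballI impI)
      fix C D assume CD: "C \<in> \<C>" "D \<in> \<C>" "C \<noteq> D"
      then have "C \<inter> D = {}" using \<C>(2) by (auto simp: disjoint_def)
      moreover have "C \<subseteq> Nvec s" "D \<subseteq> Nvec s" using CD \<C>(3) affine_lattice_subset by blast+
      ultimately show "\<Phi> ` C \<inter> \<Phi> ` D = {}"
        using inj_on_image_Int[OF assms(3)] by (metis image_empty)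
    qed
  qed
  moreover have "(\<Union>C\<in>\<C>. \<Phi> ` C) = \<Phi> ` X" using \<C>(4) by blast
  ultimately show ?thesis by simp
qed

lemma lattice_union_Nvec: "lattice_union m (Nvec m)"
proof -
  have "affine_lattice m (Nvec m)"
    unfolding affine_lattice_def
    by (rule exI[of _ m], rule exI[of _ "\<lambda>k. k"]) (simp add: affine_map_def affine_on_var_nat)
  then show ?thesis by (rule lattice_union_affine_lattice)
qed

text \<open>
  The region under the graph of an affine function is cut into the layers between consecutive
  partial sums; the residue of the height above the lower boundary of a layer, taken modulo the
  slope, then yields disjoint lattices.
\<close>

lemma lattice_union_wedge:
  "l \<le> s \<Longrightarrow> lattice_union (Suc s) {e \<in> Nvec (Suc s). e 0 < d0 + (\<Sum>i<l. d i * e (Suc i))}"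
proof (induction l)
  case 0
  have "lattice_union (Suc s) (\<Union>c<d0. (\<lambda>k. case_nat c k) ` Nvec s)"
  proof (rule lattice_union_UN)
    fix c
    have id: "affine_map s s (\<lambda>k. k)" by (simp add: affine_map_def affine_on_var_nat)
    show "lattice_union (Suc s) ((\<lambda>k. case_nat c k) ` Nvec s)"
      by (rule lattice_union_image[OF lattice_union_Nvec affine_map_case_nat[OF affine_on_const id]])
        (auto simp: inj_on_def fun_eq_iff dest: spec[of _ "Suc _"])
  next
    have "case_nat c k \<noteq> case_nat c' k'" if "c \<noteq> c'" for c c' :: nat and k k'
      using that by (metis old.nat.simps(4))
    then show "disjoint_family_on (\<lambda>c. (\<lambda>k. case_nat c k) ` Nvec s) {..<d0}"
      unfolding disjoint_family_on_def by blast
  qed simp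
  moreover have "(\<Union>c<d0. (\<lambda>k. case_nat c k) ` Nvec s) = {e \<in> Nvec (Suc s). e 0 < d0}"
    (is "?L = ?R")
  proof (intro equalityI subsetI)
    fix e assume "e \<in> ?R"
    then show "e \<in> ?L"
      using tail_Nvec[of e s] case_nat_tail[of e] by (intro UN_I[of "e 0"] image_eqI[of _ _ "tail e"]) auto
  qed (auto simp: case_nat_Nvec)
  ultimately show ?case by simp
next
  case (Suc l)
  define S where "S e = d0 + (\<Sum>i<l. d i * e (Suc i))" for e :: env
  \<comment> \<open>A point of the layer has height S + d l * q + r with r < d l, and q is strictly
    less than its coordinate \<open>Suc l\<close>. The new parameters are q and the slack that
    remains after subtracting q + 1 from that coordinate; they range freely over the natural
    numbers.\<close>
  define \<Phi> where "\<Phi> r e = (\<lambda>i. if i = 0 then S e + (d l * e 0 + r)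
      else if i = Suc l then e i + (e 0 + 1) else e i)" for r and e :: env
  define L where "L = {e \<in> Nvec (Suc s). S e \<le> e 0 \<and> e 0 < S e + d l * e (Suc l)}"
  have S\<Phi>: "S (\<Phi> r e) = S e" for r e
    by (auto simp: S_def \<Phi>_def intro!: sum.cong)
  have img: "\<Phi> r ` Nvec (Suc s) = {e \<in> L. (e 0 - S e) mod d l = r}" if r: "r < d l" for r
  proof (intro equalityI subsetI)
    fix x assume "x \<in> \<Phi> r ` Nvec (Suc s)"
    then obtain e where e: "e \<in> Nvec (Suc s)" "x = \<Phi> r e" by blast
    have "x \<in> Nvec (Suc s)" using e Suc.prems by (auto simp: \<Phi>_def Nvec_def)
    moreover have "d l * e 0 + r < d l * (e (Suc l) + (e 0 + 1))"
      using r by (simp add: distrib_left)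
    ultimately show "x \<in> {e \<in> L. (e 0 - S e) mod d l = r}"
      using r by (simp add: L_def e(2) S\<Phi>) (simp add: \<Phi>_def)
  next
    fix x assume x: "x \<in> {e \<in> L. (e 0 - S e) mod d l = r}"
    let ?q = "(x 0 - S x) div d l"
    have x': "x \<in> Nvec (Suc s)" "S x \<le> x 0" "x 0 - S x < d l * x (Suc l)"
      using x by (auto simp: L_def)
    have q: "?q < x (Suc l)"
      using x'(3) by (simp add: less_mult_imp_div_less mult.commute)
    have dm: "d l * ?q + r = x 0 - S x"
      using x mult_div_mod_eq[of "d l" "x 0 - S x"] by simp
    define e where "e = (\<lambda>i. if i = 0 then ?q else if i = Suc l then x i - (?q + 1) else x i)"
    have "S e = S x" by (auto simp: S_def e_def intro!: sum.cong)
    then have "\<Phi> r e = x"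
      using dm x'(2) q by (auto simp: \<Phi>_def e_def fun_eq_iff)
    moreover have "e \<in> Nvec (Suc s)" using x'(1) Suc.prems by (auto simp: e_def Nvec_def)
    ultimately show "x \<in> \<Phi> r ` Nvec (Suc s)" by blast
  qed
  have inj: "inj_on (\<Phi> r) X" if "r < d l" for r X
  proof (rule inj_onI)
    fix e e' assume eq: "\<Phi> r e = \<Phi> r e'"
    have "S e = S e'" using S\<Phi>[of r e] S\<Phi>[of r e'] eq by simp
    then have 0: "e 0 = e' 0"
      using fun_cong[OF eq, of 0] that by (simp add: \<Phi>_def)
    show "e = e'"
    proof
      fix i show "e i = e' i"
        using fun_cong[OF eq, of i] 0 by (auto simp: \<Phi>_def split: if_splits)
    qed
  qed
  have aff: "affine_map (Suc s) (Suc s) (\<Phi> r)" for r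
  proof -
    have "affine_on (Suc s) (\<lambda>e. \<Phi> r e i)" for i
      unfolding \<Phi>_def S_def
      by (intro affine_on_if affine_on_add affine_on_const affine_on_sum affine_on_scale
          affine_on_var_nat) simp_all
    moreover have "\<Phi> r \<in> Nvec (Suc s) \<rightarrow> Nvec (Suc s)"
      using Suc.prems by (auto simp: \<Phi>_def Nvec_def)
    ultimately show ?thesis by (simp add: affine_map_def)
  qed
  have "lattice_union (Suc s) (\<Union>r<d l. {e \<in> L. (e 0 - S e) mod d l = r})"
  proof (rule lattice_union_UN)
    show "lattice_union (Suc s) {e \<in> L. (e 0 - S e) mod d l = r}" if "r \<in> {..<d l}" for r
      using that lattice_union_image[OF lattice_union_Nvec aff inj, of r] by (simp add: img)
  qed (auto simp: disjoint_family_on_def)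
  moreover have "(\<Union>r<d l. {e \<in> L. (e 0 - S e) mod d l = r}) = L"
  proof -
    have "d l > 0" if "e \<in> L" for e
      using that by (cases "d l = 0") (auto simp: L_def)
    then show ?thesis by (auto simp: mod_less_divisor)
  qed
  ultimately have "lattice_union (Suc s) L" by simp
  moreover have "lattice_union (Suc s) {e \<in> Nvec (Suc s). e 0 < S e}"
    unfolding S_def using Suc by simp
  ultimately have "lattice_union (Suc s) ({e \<in> Nvec (Suc s). e 0 < S e} \<union> L)"
    by (intro lattice_union_Un) (auto simp: L_def)
  moreover have "{e \<in> Nvec (Suc s). e 0 < S e} \<union> L =
      {e \<in> Nvec (Suc s). e 0 < d0 + (\<Sum>i<Suc l. d i * e (Suc i))}"
    by (auto simp: L_def S_def add.assoc)
  ultimately show ?case by simp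
qed

text \<open>For r < M this is the least number that is at least y and congruent to r modulo M.
  Adding M before subtracting keeps the subtraction of natural numbers from being truncated.\<close>

definition residue_ge :: "nat \<Rightarrow> nat \<Rightarrow> nat \<Rightarrow> nat" where
  "residue_ge M r y = y + (r + M - y mod M) mod M"

lemma residue_ge_mod:
  assumes "r < M"
  shows "residue_ge M r y mod M = r"
proof -
  have "y mod M \<le> M" using assms mod_less_divisor[of M y] by linarith
  have "residue_ge M r y mod M = (y mod M + (r + M - y mod M)) mod M"
    by (simp add: residue_ge_def mod_add_eq mod_add_left_eq mod_add_right_eq)
  also have "y mod M + (r + M - y mod M) = r + M" using \<open>y mod M \<le> M\<close> by simp
  finally show ?thesis using assms by simp
qed

lemma residue_ge_ge: "y \<le> residue_ge M r y"
  by (simp add: residue_ge_def)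

lemma residue_ge_le:
  assumes "r < M" "y \<le> z" "z mod M = r"
  shows "residue_ge M r y \<le> z"
proof -
  define x where "x = z - y"
  have z: "z = y + x" using assms(2) by (simp add: x_def)
  have lt: "y mod M < M" using assms(1) by (intro mod_less_divisor) simp
  have "(r + M - y mod M) mod M = ((y + x) mod M + (M - y mod M)) mod M"
    using assms(3) lt by (simp add: z)
  also have "\<dots> = (y mod M + x + (M - y mod M)) mod M"
    by (simp add: mod_add_left_eq) (metis mod_add_left_eq)
  also have "\<dots> = (x + M) mod M" using lt by (simp add: add.commute)
  also have "\<dots> \<le> x" by simp
  finally show ?thesis by (simp add: residue_ge_def z)
qed

lemma threshold_residue_ge:
  assumes "threshold \<tau>" "0 < M"
  shows "threshold (\<lambda>e. residue_ge M r (\<tau> e))"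
  unfolding residue_ge_def by (rule threshold_add_mod[OF assms, where g = "\<lambda>t. (r + M - t) mod M"])

text \<open>Reduces a set fibred over N^m to the case of a base that is a single lattice on which
  the two given functions are affine. The base is first cut into the cells on which both are
  polynomials of degree at most 1, and each cell meeting \<open>A\<close> is decomposed by the
  hypothesis on dimension m; disjointness of the bases gives disjointness of the sets above
  them.\<close>

lemma lattice_union_fibres:
  assumes IH: "\<And>A. presb A \<Longrightarrow> lattice_union m {x \<in> Nvec m. A x}"
    and A: "presb A"
    and f: "pwpoly 1 (\<lambda>x. of_nat (f x))" and g: "pwpoly 1 (\<lambda>x. of_nat (g x))"
    and step: "\<And>s \<Phi>. affine_map s m \<Phi> \<Longrightarrow> inj_on \<Phi> (Nvec s) \<Longrightarrow>
      affine_on s (\<lambda>k. f (\<Phi> k)) \<Longrightarrow> affine_on s (\<lambda>k. g (\<Phi> k)) \<Longrightarrow>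
      lattice_union (Suc m) {e \<in> Nvec (Suc m). tail e \<in> \<Phi> ` Nvec s \<and> Q e}"
  shows "lattice_union (Suc m) {e \<in> Nvec (Suc m). A (tail e) \<and> Q e}"
proof -
  obtain Pf Pg where Pf: "finite Pf" "\<forall>A\<in>Pf. presb A"
      "\<And>V. \<exists>p. polyfun 1 p \<and> (\<forall>x. cell Pf V x \<longrightarrow> of_nat (f x) = p x)"
    and Pg: "finite Pg" "\<forall>A\<in>Pg. presb A"
      "\<And>V. \<exists>p. polyfun 1 p \<and> (\<forall>x. cell Pg V x \<longrightarrow> of_nat (g x) = p x)"
    using pwpoly_pieces[OF f] pwpoly_pieces[OF g] by metis
  define P where "P = Pf \<union> Pg"
  have P: "finite P" "\<forall>A\<in>P. presb A" using Pf Pg by (auto simp: P_def)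
  have piece: "lattice_union (Suc m) {e \<in> Nvec (Suc m). A (tail e) \<and> cell P V (tail e) \<and> Q e}" for V
  proof -
    obtain \<C> where \<C>: "finite \<C>" "disjoint \<C>" "\<forall>C\<in>\<C>. affine_lattice m C"
      "\<Union>\<C> = {x \<in> Nvec m. A x \<and> cell P V x}"
      using IH[OF presb.conj[OF A presb_cell[OF P]], of V] unfolding lattice_union_def by blast
    have "lattice_union (Suc m) (\<Union>C\<in>\<C>. {e \<in> Nvec (Suc m). tail e \<in> C \<and> Q e})"
    proof (rule lattice_union_UN[OF \<C>(1)])
      fix C assume C: "C \<in> \<C>"
      then obtain s \<Phi> where \<Phi>: "affine_map s m \<Phi>" "inj_on \<Phi> (Nvec s)" "C = \<Phi> ` Nvec s"
        using \<C>(3) unfolding affine_lattice_def by blast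
      have cell: "cell P V (\<Phi> k)" if "k \<in> Nvec s" for k
        using \<C>(4) C \<Phi>(3) that by blast
      obtain p q where p: "polyfun 1 p" "\<forall>x. cell Pf V x \<longrightarrow> of_nat (f x) = p x"
        and q: "polyfun 1 q" "\<forall>x. cell Pg V x \<longrightarrow> of_nat (g x) = q x"
        using Pf(3)[of V] Pg(3)[of V] by blast
      have "affine_on s (\<lambda>k. of_nat (f (\<Phi> k)) :: rat)"
        using polyfun_affine[OF p(1) \<Phi>(1)] p(2) cell
        by (subst affine_on_cong[where g = "\<lambda>k. p (\<Phi> k)"]) (auto simp: cell_def P_def)
      moreover have "affine_on s (\<lambda>k. of_nat (g (\<Phi> k)) :: rat)"
        using polyfun_affine[OF q(1) \<Phi>(1)] q(2) cell
        by (subst affine_on_cong[where g = "\<lambda>k. q (\<Phi> k)"]) (auto simp: cell_def P_def)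
      ultimately show "lattice_union (Suc m) {e \<in> Nvec (Suc m). tail e \<in> C \<and> Q e}"
        unfolding \<Phi>(3) by (intro step \<Phi>(1,2) affine_on_nat)
    next
      show "disjoint_family_on (\<lambda>C. {e \<in> Nvec (Suc m). tail e \<in> C \<and> Q e}) \<C>"
      proof (unfold disjoint_family_on_def, intro ballI impI)
        fix C D assume "C \<in> \<C>" "D \<in> \<C>" "C \<noteq> D"
        then have "C \<inter> D = {}" using \<C>(2) by (auto simp: disjoint_def)
        then show "{e \<in> Nvec (Suc m). tail e \<in> C \<and> Q e} \<inter> {e \<in> Nvec (Suc m). tail e \<in> D \<and> Q e} = {}"
          by blast
      qed
    qed
    moreover have "(\<Union>C\<in>\<C>. {e \<in> Nvec (Suc m). tail e \<in> C \<and> Q e}) =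
        {e \<in> Nvec (Suc m). tail e \<in> \<Union>\<C> \<and> Q e}" by blast
    moreover have "\<dots> = {e \<in> Nvec (Suc m). A (tail e) \<and> cell P V (tail e) \<and> Q e}"
      unfolding \<C>(4) using tail_Nvec by blast
    ultimately show ?thesis by simp
  qed
  have "lattice_union (Suc m)
      (\<Union>V\<in>Pow P. {e \<in> Nvec (Suc m). A (tail e) \<and> cell P V (tail e) \<and> Q e})"
    using ex1_cell[of P]
    by (intro lattice_union_UN piece) (auto simp: P disjoint_family_on_def)
  moreover have "(\<Union>V\<in>Pow P. {e \<in> Nvec (Suc m). A (tail e) \<and> cell P V (tail e) \<and> Q e}) =
      {e \<in> Nvec (Suc m). A (tail e) \<and> Q e}" (is "?L = ?R")
  proof (intro equalityI subsetI)
    fix e assume e: "e \<in> ?R"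
    obtain V where "V \<in> Pow P" "cell P V (tail e)" using ex1_cell[of P "tail e"] by auto
    then show "e \<in> ?L" using e by (intro UN_I[of V]) simp_all
  qed auto
  ultimately show ?thesis by simp
qed

section \<open>Arithmetic progressions over a lattice\<close>

lemma affine_map_progression:
  assumes "affine_map s m \<Phi>" "inj_on \<Phi> (Nvec s)" "affine_on s a" "0 < M"
  defines "\<Psi> \<equiv> \<lambda>e. case_nat (a (tail e) + M * e 0) (\<Phi> (tail e))"
  shows "affine_map (Suc s) (Suc m) \<Psi>" "inj_on \<Psi> (Nvec (Suc s))"
proof -
  show "affine_map (Suc s) (Suc m) \<Psi>"
    unfolding \<Psi>_def
    by (intro affine_map_case_nat affine_on_add affine_on_scale affine_on_var_nat
        affine_on_compose[OF assms(3) affine_map_tail]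
        affine_map_compose[OF affine_map_tail assms(1)])
  show "inj_on \<Psi> (Nvec (Suc s))"
  proof (rule inj_onI)
    fix e e' assume e: "e \<in> Nvec (Suc s)" "e' \<in> Nvec (Suc s)" and eq: "\<Psi> e = \<Psi> e'"
    have "\<Phi> (tail e) = \<Phi> (tail e')"
      using fun_cong[OF eq, of "Suc _"] by (simp add: \<Psi>_def fun_eq_iff)
    then have t: "tail e = tail e'" using assms(2) e tail_Nvec by (metis inj_onD)
    moreover have "e 0 = e' 0"
      using fun_cong[OF eq, of 0] t assms(4) by (simp add: \<Psi>_def)
    ultimately show "e = e'" by (metis case_nat_tail)
  qed
qed

text \<open>Over a lattice on which the starting point is affine, the position in the progression is
  one more free parameter, so the ray is itself a lattice.\<close>

lemma lattice_union_ray: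
  assumes IH: "\<And>A. presb A \<Longrightarrow> lattice_union m {x \<in> Nvec m. A x}"
    and A: "presb A" and a: "threshold a" and M: "0 < M"
  shows "lattice_union (Suc m)
    {e \<in> Nvec (Suc m). A (tail e) \<and> (\<exists>j. e 0 = a (tail e) + M * j)}"
proof (rule lattice_union_fibres[OF IH A pwpoly_threshold[OF a] pwpoly_threshold[OF a]])
  fix s \<Phi> assume \<Phi>: "affine_map s m \<Phi>" "inj_on \<Phi> (Nvec s)" "affine_on s (\<lambda>k. a (\<Phi> k))"
  let ?\<Psi> = "\<lambda>e. case_nat (a (\<Phi> (tail e)) + M * e 0) (\<Phi> (tail e))"
  have "lattice_union (Suc m) (?\<Psi> ` Nvec (Suc s))"
    by (rule lattice_union_image[OF lattice_union_Nvec affine_map_progression[OF \<Phi> M]])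
  moreover have "?\<Psi> ` Nvec (Suc s) =
      {e \<in> Nvec (Suc m). tail e \<in> \<Phi> ` Nvec s \<and> (\<exists>j. e 0 = a (tail e) + M * j)}" (is "?L = ?R")
  proof (intro equalityI subsetI)
    fix e assume "e \<in> ?R"
    then obtain k j where k: "k \<in> Nvec s" "tail e = \<Phi> k" "e 0 = a (tail e) + M * j" by blast
    then have "case_nat (e 0) (tail e) = ?\<Psi> (case_nat j k)" by (simp del: case_nat_tail)
    then have "e = ?\<Psi> (case_nat j k)" unfolding case_nat_tail .
    then show "e \<in> ?L" using case_nat_Nvec[OF k(1)] by blast
  next
    fix x assume "x \<in> ?L"
    then obtain e where e: "e \<in> Nvec (Suc s)" "x = ?\<Psi> e" by blast
    have "\<Phi> (tail e) \<in> Nvec m" using \<Phi>(1) tail_Nvec[OF e(1)] by (auto simp: affine_map_def)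
    then show "x \<in> ?R" using e(2) tail_Nvec[OF e(1)] by (auto simp: case_nat_Nvec)
  qed
  ultimately show "lattice_union (Suc m)
      {e \<in> Nvec (Suc m). tail e \<in> \<Phi> ` Nvec s \<and> (\<exists>j. e 0 = a (tail e) + M * j)}" by simp
qed

text \<open>Over a lattice on which both the starting point and the number of terms are affine, the
  position in the progression lies below the graph of an affine function of the parameters. The set
  is thus an injective affine image of a wedge.\<close>

lemma lattice_union_segment:
  assumes IH: "\<And>A. presb A \<Longrightarrow> lattice_union m {x \<in> Nvec m. A x}"
    and A: "presb A" and a: "threshold a" and M: "0 < M" and \<delta>: "pwpoly 1 (\<lambda>x. of_nat (\<delta> x))"
  shows "lattice_union (Suc m)
    {e \<in> Nvec (Suc m). A (tail e) \<and> (\<exists>j<\<delta> (tail e). e 0 = a (tail e) + M * j)}"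
proof (rule lattice_union_fibres[OF IH A pwpoly_threshold[OF a] \<delta>])
  fix s \<Phi> assume \<Phi>: "affine_map s m \<Phi>" "inj_on \<Phi> (Nvec s)" "affine_on s (\<lambda>k. a (\<Phi> k))"
    and "affine_on s (\<lambda>k. \<delta> (\<Phi> k))"
  then obtain d0 d where d: "\<And>k. k \<in> Nvec s \<Longrightarrow> \<delta> (\<Phi> k) = d0 + (\<Sum>i<s. d i * k i)"
    unfolding affine_on_def by auto
  let ?\<Psi> = "\<lambda>e. case_nat (a (\<Phi> (tail e)) + M * e 0) (\<Phi> (tail e))"
  let ?W = "{e \<in> Nvec (Suc s). e 0 < d0 + (\<Sum>i<s. d i * e (Suc i))}"
  have "lattice_union (Suc m) (?\<Psi> ` ?W)"
    by (rule lattice_union_image[OF lattice_union_wedge[OF order_refl] affine_map_progression[OF \<Phi> M]])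
  moreover have "?\<Psi> ` ?W = {e \<in> Nvec (Suc m). tail e \<in> \<Phi> ` Nvec s \<and>
      (\<exists>j<\<delta> (tail e). e 0 = a (tail e) + M * j)}" (is "?L = ?R")
  proof (intro equalityI subsetI)
    fix e assume "e \<in> ?R"
    then obtain k j where k: "k \<in> Nvec s" "tail e = \<Phi> k" "e 0 = a (tail e) + M * j" "j < \<delta> (tail e)"
      by blast
    then have "case_nat (e 0) (tail e) = ?\<Psi> (case_nat j k)" by (simp del: case_nat_tail)
    then have "e = ?\<Psi> (case_nat j k)" unfolding case_nat_tail .
    moreover have "case_nat j k \<in> ?W" using case_nat_Nvec[OF k(1)] k(4) d[OF k(1)] unfolding k(2) by simp
    ultimately show "e \<in> ?L" by blast
  next
    fix x assume "x \<in> ?L"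
    then obtain e where e: "e \<in> Nvec (Suc s)" "x = ?\<Psi> e" "e 0 < d0 + (\<Sum>i<s. d i * e (Suc i))" by blast
    have "\<Phi> (tail e) \<in> Nvec m" using \<Phi>(1) tail_Nvec[OF e(1)] by (auto simp: affine_map_def)
    moreover have "e 0 < \<delta> (\<Phi> (tail e))" using e(3) d[OF tail_Nvec[OF e(1)]] by simp
    ultimately show "x \<in> ?R" using e(2) tail_Nvec[OF e(1)] by (auto simp: case_nat_Nvec)
  qed
  ultimately show "lattice_union (Suc m) {e \<in> Nvec (Suc m). tail e \<in> \<Phi> ` Nvec s \<and>
      (\<exists>j<\<delta> (tail e). e 0 = a (tail e) + M * j)}" by simp
qed

lemma progression_iff:
  fixes a y M r :: nat
  assumes "0 < M" "a mod M = r"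
  shows "(\<exists>j. y = a + M * j) \<longleftrightarrow> y mod M = r \<and> a \<le> y"
proof
  assume "y mod M = r \<and> a \<le> y"
  then have "M dvd y - a" using assms(2) by (metis mod_eq_dvd_iff_nat)
  then show "\<exists>j. y = a + M * j"
    using \<open>y mod M = r \<and> a \<le> y\<close> by (metis dvd_def le_add_diff_inverse)
qed (use assms in auto)

text \<open>Since both bounds have the same residue, the division is exact and the number of terms
  between them is a rational multiple of their difference. Rounding both ends to one residue class
  is what makes this number piecewise affine.\<close>

lemma pwpoly_div_diff:
  assumes "threshold a" "threshold b" "0 < M" "\<And>x. a x mod M = b x mod M"
  shows "pwpoly 1 (\<lambda>x. of_nat ((b x - a x) div M))"
proof -
  have "pwpoly 1 (\<lambda>x. if a x \<le> b x then (1 / of_nat M) * (of_nat (b x) - of_nat (a x)) else 0)"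
    by (intro pwpoly_if pwpoly_mult0 pwpoly_diff pwpoly.const presb_le_threshold pwpoly_threshold assms)
  then show ?thesis
  proof (rule pwpoly_cong)
    fix x
    show "(if a x \<le> b x then (1 / of_nat M) * (of_nat (b x) - of_nat (a x)) else 0 :: rat) =
        of_nat ((b x - a x) div M)"
    proof (cases "a x \<le> b x")
      case True
      then have "M dvd b x - a x" using assms(4)[of x] by (metis mod_eq_dvd_iff_nat)
      then obtain q where q: "b x - a x = M * q" by blast
      then have "of_nat (b x) - of_nat (a x) = (of_nat (M * q) :: rat)"
        using True by (metis of_nat_diff)
      then show ?thesis using True q assms(3) by simp
    qed simp
  qed
qed

lemma lattice_union_presb:
  "presb A \<Longrightarrow> lattice_union m {e \<in> Nvec m. A e}"
proof (induction m arbitrary: A)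
  case 0
  have "{e \<in> Nvec 0. A e} = (if A (\<lambda>_. 0) then Nvec 0 else {})"
    by (auto simp: Nvec_def fun_eq_iff[symmetric])
  then show ?case by (simp add: lattice_union_empty lattice_union_Nvec)
next
  case (Suc m)
  obtain T M where T: "finite T" "\<forall>\<tau>\<in>T. threshold \<tau>" "(\<lambda>_. 0) \<in> T" and M: "0 < M"
    and det: "determined_by T M A"
    using presb_determined_by[OF Suc.prems] .
  \<comment> \<open>\<open>S\<close> records the thresholds that the first coordinate has reached
    and \<open>r\<close> its residue. Once these and the tail are fixed, \<open>A\<close> has a
    single truth value.\<close>
  define X where "X = (\<lambda>(S, r). {e \<in> Nvec (Suc m). A e \<and> e 0 mod M = r \<and> {\<tau> \<in> T. \<tau> (tail e) \<le> e 0} = S})"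
  have A_cong: "A e \<longleftrightarrow> A (case_nat z (tail e))"
    if "e 0 mod M = z mod M" "\<And>\<tau>. \<tau> \<in> T \<Longrightarrow> \<tau> (tail e) \<le> e 0 \<longleftrightarrow> \<tau> (tail e) \<le> z" for e z
    using det that unfolding determined_by_def by (metis case_nat_tail)
  have X: "lattice_union (Suc m) (X (S, r))" if S: "S \<subseteq> T" and r: "r < M" for S r
  proof (cases "S = {}")
    case True
    \<comment> \<open>The threshold 0 is in \<open>T\<close> and is always reached.\<close>
    have "X (S, r) = {}" using T(3) by (auto simp: X_def True)
    then show ?thesis by (simp add: lattice_union_empty)
  next
    case ne: False
    have S': "finite S" "\<forall>\<tau>\<in>S. threshold \<tau>" using S T finite_subset by auto
    define a where "a x = residue_ge M r (Max ((\<lambda>\<tau>. \<tau> x) ` S))" for x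
    have a: "threshold a"
      unfolding a_def by (intro threshold_residue_ge threshold_Max S' ne M)
    have a_mod: "a x mod M = r" for x unfolding a_def by (rule residue_ge_mod[OF r])
    have a_le: "a x \<le> y \<longleftrightarrow> (\<forall>\<tau>\<in>S. \<tau> x \<le> y)" if "y mod M = r" for x y
    proof -
      have "a x \<le> y \<longleftrightarrow> Max ((\<lambda>\<tau>. \<tau> x) ` S) \<le> y"
        unfolding a_def using residue_ge_le[OF r _ that] residue_ge_ge order_trans by metis
      then show ?thesis using S' ne by simp
    qed
    \<comment> \<open>The truth value of \<open>A\<close> along the progression is read off at its
      first point \<open>a x\<close>; substituting this threshold leaves a Presburger condition on
      the tail alone.\<close>
    have Aa: "presb (\<lambda>x. A (case_nat (a x) x))" by (rule presb_subst[OF a Suc.prems])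
    show ?thesis
    proof (cases "S = T")
      case True
      \<comment> \<open>All thresholds have been reached, so nothing bounds the first coordinate
        from above.\<close>
      have "X (S, r) = {e \<in> Nvec (Suc m). A (case_nat (a (tail e)) (tail e)) \<and>
          (\<exists>j. e 0 = a (tail e) + M * j)}"
      proof -
        have "A e \<and> e 0 mod M = r \<and> {\<tau> \<in> T. \<tau> (tail e) \<le> e 0} = S \<longleftrightarrow>
          A (case_nat (a (tail e)) (tail e)) \<and> e 0 mod M = r \<and> a (tail e) \<le> e 0" for e
        proof (cases "e 0 mod M = r \<and> a (tail e) \<le> e 0")
          case le: True
          have 1: "\<forall>\<tau>\<in>S. \<tau> (tail e) \<le> e 0" using le a_le[of "e 0" "tail e"] by simp
          have 2: "\<forall>\<tau>\<in>S. \<tau> (tail e) \<le> a (tail e)"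
            using a_le[of "a (tail e)" "tail e"] a_mod by simp
          have "A e \<longleftrightarrow> A (case_nat (a (tail e)) (tail e))"
            by (rule A_cong) (use 1 2 le a_mod True in auto)
          moreover have "{\<tau> \<in> T. \<tau> (tail e) \<le> e 0} = S" using 1 True by auto
          ultimately show ?thesis using le by simp
        next
          case False
          have "a (tail e) \<le> e 0" if "e 0 mod M = r" "{\<tau> \<in> T. \<tau> (tail e) \<le> e 0} = S"
          proof -
            have "\<forall>\<tau>\<in>S. \<tau> (tail e) \<le> e 0" using that(2) by auto
            then show ?thesis using a_le[OF that(1), of "tail e"] by simp
          qed
          then show ?thesis using False by blast
        qed
        then show ?thesis unfolding X_def progression_iff[OF M a_mod] prod.case by (intro Collect_cong) simp
      qed
      then show ?thesis using lattice_union_ray[OF Suc.IH Aa a M] by simp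
    next
      case False
      \<comment> \<open>Rounding the strict upper bound up does not change which numbers of residue
        r lie below it.\<close>
      define b where "b x = residue_ge M r (Min ((\<lambda>\<tau>. \<tau> x) ` (T - S)))" for x
      have TS: "finite (T - S)" "T - S \<noteq> {}" "\<forall>\<tau>\<in>T - S. threshold \<tau>"
        using T S False by auto
      have b: "threshold b"
        unfolding b_def by (intro threshold_residue_ge threshold_Min TS M)
      have b_mod: "b x mod M = r" for x unfolding b_def by (rule residue_ge_mod[OF r])
      have less_b: "y < b x \<longleftrightarrow> (\<forall>\<tau>\<in>T - S. y < \<tau> x)" if "y mod M = r" for x y
      proof -
        have "b x \<le> y \<longleftrightarrow> Min ((\<lambda>\<tau>. \<tau> x) ` (T - S)) \<le> y"
          unfolding b_def using residue_ge_le[OF r _ that] residue_ge_ge order_trans by metis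
        then have "y < b x \<longleftrightarrow> y < Min ((\<lambda>\<tau>. \<tau> x) ` (T - S))" by (simp only: not_le[symmetric])
        then show ?thesis using TS by simp
      qed
      let ?B = "\<lambda>x. A (case_nat (a x) x) \<and> a x \<le> b x"
      have B: "presb ?B" by (intro presb.conj Aa presb_le_threshold a b)
      have \<delta>: "pwpoly 1 (\<lambda>x. of_nat ((b x - a x) div M))"
        by (intro pwpoly_div_diff a b M) (simp add: a_mod b_mod)
      have "X (S, r) = {e \<in> Nvec (Suc m). ?B (tail e) \<and>
          (\<exists>j<(b (tail e) - a (tail e)) div M. e 0 = a (tail e) + M * j)}"
      proof -
        have "A e \<and> e 0 mod M = r \<and> {\<tau> \<in> T. \<tau> (tail e) \<le> e 0} = S \<longleftrightarrow>
          A (case_nat (a (tail e)) (tail e)) \<and> e 0 mod M = r \<and> a (tail e) \<le> e 0 \<and> e 0 < b (tail e)" for e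
        proof (cases "e 0 mod M = r \<and> a (tail e) \<le> e 0 \<and> e 0 < b (tail e)")
          case le: True
          have 1: "\<forall>\<tau>\<in>S. \<tau> (tail e) \<le> e 0" "\<forall>\<tau>\<in>T - S. e 0 < \<tau> (tail e)"
            using le a_le[of "e 0" "tail e"] less_b[of "e 0" "tail e"] by simp_all
          have 2: "\<forall>\<tau>\<in>S. \<tau> (tail e) \<le> a (tail e)" "\<forall>\<tau>\<in>T - S. a (tail e) < \<tau> (tail e)"
            using a_le[of "a (tail e)" "tail e"] less_b[of "a (tail e)" "tail e"] a_mod le by simp_all
          have "\<tau> (tail e) \<le> e 0 \<longleftrightarrow> \<tau> (tail e) \<le> a (tail e)" if "\<tau> \<in> T" for \<tau>
            using 1 2 that by (metis DiffI leD)
          then have "A e \<longleftrightarrow> A (case_nat (a (tail e)) (tail e))"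
            using le a_mod by (intro A_cong) simp_all
          moreover have "{\<tau> \<in> T. \<tau> (tail e) \<le> e 0} = S"
            using 1 S by (auto simp: not_le dest: leD)
          ultimately show ?thesis using le by simp
        next
          case False
          have "a (tail e) \<le> e 0 \<and> e 0 < b (tail e)"
            if "e 0 mod M = r" "{\<tau> \<in> T. \<tau> (tail e) \<le> e 0} = S"
          proof -
            have "\<forall>\<tau>\<in>S. \<tau> (tail e) \<le> e 0" "\<forall>\<tau>\<in>T - S. e 0 < \<tau> (tail e)"
              using that(2) by (auto simp: not_le)
            then show ?thesis
              using a_le[OF that(1), of "tail e"] less_b[OF that(1), of "tail e"] by simp
          qed
          then show ?thesis using False by blast
        qed
        moreover have "a x \<le> b x \<and> (\<exists>j<(b x - a x) div M. y = a x + M * j) \<longleftrightarrow>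
            y mod M = r \<and> a x \<le> y \<and> y < b x" for x y
        proof -
          have "j < (b x - a x) div M \<longleftrightarrow> a x + M * j < b x" if "a x \<le> b x" for j
          proof -
            have "M dvd b x - a x" using that a_mod b_mod by (metis mod_eq_dvd_iff_nat)
            then obtain q where q: "b x - a x = M * q" by blast
            have "M * j < M * q \<longleftrightarrow> a x + M * j < b x" using q that by linarith
            then show ?thesis using q M by simp
          qed
          then show ?thesis
            using progression_iff[OF M a_mod[of x], of y]
            by (metis le_add1 order.strict_implies_order order.strict_trans1)
        qed
        ultimately show ?thesis unfolding X_def prod.case by (intro Collect_cong) blast
      qed
      then show ?thesis using lattice_union_segment[OF Suc.IH B a M \<delta>] by simp
    qed
  qed
  have "lattice_union (Suc m) (\<Union>i\<in>Pow T \<times> {..<M}. X i)"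
  proof (rule lattice_union_UN)
    show "disjoint_family_on X (Pow T \<times> {..<M})"
      by (auto simp: disjoint_family_on_def X_def)
    show "lattice_union (Suc m) (X i)" if "i \<in> Pow T \<times> {..<M}" for i
    proof -
      obtain S r where "i = (S, r)" by (cases i)
      then show ?thesis using X[of S r] that by simp
    qed
  qed (simp add: T(1))
  moreover have "(\<Union>i\<in>Pow T \<times> {..<M}. X i) = {e \<in> Nvec (Suc m). A e}"
  proof (intro equalityI subsetI)
    fix e assume e: "e \<in> {e \<in> Nvec (Suc m). A e}"
    show "e \<in> (\<Union>i\<in>Pow T \<times> {..<M}. X i)"
      by (rule UN_I[of "({\<tau> \<in> T. \<tau> (tail e) \<le> e 0}, e 0 mod M)"]) (use e M in \<open>auto simp: X_def\<close>)
  qed (auto simp: X_def)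
  ultimately show ?case by simp
qed

section \<open>Transfer to integer vectors\<close>

definition int_vec :: "nat \<Rightarrow> env \<Rightarrow> int vec" where
  "int_vec n e = vec n (\<lambda>i. int (e i))"

lemma inj_on_int_vec: "inj_on (int_vec n) (Nvec n)"
proof (rule inj_onI, rule ext)
  fix e e' i assume "e \<in> Nvec n" "e' \<in> Nvec n" "int_vec n e = int_vec n e'"
  then show "e i = e' i"
    unfolding Nvec_def int_vec_def vec_eq_iff by (cases "i < n") (auto simp: not_less)
qed

lemma int_vec_image: "int_vec n ` Nvec n = map_vec int ` carrier_vec n"
proof (intro equalityI subsetI)
  fix v assume "v \<in> int_vec n ` Nvec n"
  then obtain e where "v = int_vec n e" by blast
  then have "v = map_vec int (vec n e)" by (auto simp: int_vec_def)
  then show "v \<in> map_vec int ` carrier_vec n" by auto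
next
  fix v assume "v \<in> map_vec int ` carrier_vec n"
  then obtain x where x: "x \<in> carrier_vec n" "v = map_vec int x" by blast
  let ?e = "\<lambda>i. if i < n then x $ i else 0"
  have "v = int_vec n ?e" using x by (auto simp: int_vec_def vec_eq_iff)
  moreover have "?e \<in> Nvec n" by (simp add: Nvec_def)
  ultimately show "v \<in> int_vec n ` Nvec n" by blast
qed

text \<open>The periods are the columns of coefficients of the parametrisation. An integer relation
  between them, separated into its positive and negative parts, yields two parameters in N^s with
  the same image; injectivity makes the parts equal, and the relation is trivial.\<close>

lemma fundamental_lattice_int_vec:
  assumes "affine_lattice n C"
  shows "fundamental_lattice n (int_vec n ` C)"
proof -
  obtain s \<Phi> where \<Phi>: "affine_map s n \<Phi>" "inj_on \<Phi> (Nvec s)" and C: "C = \<Phi> ` Nvec s"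
    using assms unfolding affine_lattice_def by blast
  have "\<forall>v. \<exists>c a. \<forall>k\<in>Nvec s. \<Phi> k v = c + (\<Sum>i<s. a i * k i)"
    using \<Phi>(1) unfolding affine_map_def affine_on_def by simp
  then obtain c a where \<Phi>_eq: "\<And>v k. k \<in> Nvec s \<Longrightarrow> \<Phi> k v = c v + (\<Sum>i<s. a v i * k i)"
    by metis
  define p where "p i = vec n (\<lambda>v. int (a v i))" for i
  have eqI: "k = k'" if k: "k \<in> Nvec s" "k' \<in> Nvec s"
    and eq: "\<And>v. v < n \<Longrightarrow> (\<Sum>i<s. int (k i) * p i $ v) = (\<Sum>i<s. int (k' i) * p i $ v)" for k k'
  proof -
    have "\<Phi> k v = \<Phi> k' v" for v
    proof (cases "v < n")
      case True
      have "int (\<Sum>i<s. a v i * k i) = int (\<Sum>i<s. a v i * k' i)"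
        using eq[OF True] True by (simp add: p_def mult.commute)
      then show ?thesis using \<Phi>_eq k by (simp only: of_nat_eq_iff)
    next
      case False
      then show ?thesis using \<Phi>(1) k by (auto simp: affine_map_def Nvec_def Pi_iff)
    qed
    then have "\<Phi> k = \<Phi> k'" by (rule ext)
    then show ?thesis by (rule inj_onD[OF \<Phi>(2) _ k])
  qed
  \<comment> \<open>Equal columns would give two unit vectors the same image. Sums over the set of
    periods can therefore be indexed by \<open>{..<s}\<close>.\<close>
  have inj: "inj_on p {..<s}"
  proof (rule inj_onI)
    fix i j assume ij: "i \<in> {..<s}" "j \<in> {..<s}" "p i = p j"
    let ?u = "\<lambda>i l. if l = i then 1 else 0 :: nat"
    have u: "(\<Sum>l<s. int (?u i l) * p l $ v) = p i $ v" if "i < s" for i v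
    proof -
      have "(\<Sum>l<s. int (?u i l) * p l $ v) = (\<Sum>l<s. if l = i then p l $ v else 0)"
        by (rule sum.cong) auto
      then show ?thesis using that by simp
    qed
    have "?u i = ?u j"
    proof (rule eqI)
      show "?u i \<in> Nvec s" "?u j \<in> Nvec s" using ij by (auto simp: Nvec_def)
      show "(\<Sum>l<s. int (?u i l) * p l $ v) = (\<Sum>l<s. int (?u j l) * p l $ v)" for v
        using ij u by simp
    qed
    then show "i = j" by (metis zero_neq_one)
  qed
  have p: "p i \<in> carrier_vec n" for i by (simp add: p_def)
  let ?P = "p ` {..<s}"
  interpret vec_module "TYPE(int)" n .
  have indpt: "lin_indpt ?P"
  proof
    assume "lin_dep ?P"
    then obtain g q where g: "lincomb g ?P = 0\<^sub>v n" and q: "q \<in> ?P" "g q \<noteq> 0"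
      using finite_lin_dep[of ?P] p by auto
    \<comment> \<open>For each index at most one of the two is nonzero, and their difference is the
      coefficient, so equality of \<open>pos\<close> and \<open>neg\<close> forces every coefficient
      to be 0.\<close>
    define pos neg where "pos i = (if i < s then nat (g (p i)) else 0)"
      and "neg i = (if i < s then nat (- g (p i)) else 0)" for i
    have "pos = neg"
    proof (rule eqI)
      show "pos \<in> Nvec s" "neg \<in> Nvec s" by (auto simp: pos_def neg_def Nvec_def)
      fix v assume v: "v < n"
      have P: "?P \<subseteq> carrier_vec n" using p by blast
      then have "(\<lambda>x. g x \<cdot>\<^sub>v x) \<in> ?P \<rightarrow> carrier_vec n" by auto
      then have "lincomb g ?P $ v = (\<Sum>x\<in>?P. (g x \<cdot>\<^sub>v x) $ v)"
        unfolding lincomb_def by (rule finsum_index[OF v _ P])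
      also have "\<dots> = (\<Sum>x\<in>?P. g x * x $ v)"
        by (rule sum.cong) (use P v in auto)
      finally have "0 = (\<Sum>x\<in>?P. g x * x $ v)" using v by (simp add: g)
      also have "\<dots> = (\<Sum>i<s. g (p i) * p i $ v)"
        by (simp add: sum.reindex[OF inj])
      also have "\<dots> = (\<Sum>i<s. int (pos i) * p i $ v - int (neg i) * p i $ v)"
        by (rule sum.cong) (auto simp: pos_def neg_def simp flip: left_diff_distrib)
      finally show "(\<Sum>i<s. int (pos i) * p i $ v) = (\<Sum>i<s. int (neg i) * p i $ v)"
        by (simp add: sum_subtractf)
    qed
    moreover obtain i where i: "i < s" "q = p i" using q(1) by blast
    ultimately have "pos i = neg i" by simp
    then have "nat (g q) = nat (- g q)" using i unfolding pos_def neg_def by simp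
    then show False using q(2) by simp
  qed
  let ?c = "vec n (\<lambda>v. int (c v))"
  have comb: "?c + finsum_vec TYPE(int) n (\<lambda>p. int (k p) \<cdot>\<^sub>v p) ?P = int_vec n (\<Phi> (\<lambda>i. if i < s then k (p i) else 0))"
    for k
  proof (rule eq_vecI)
    have carr: "(\<lambda>p. int (k p) \<cdot>\<^sub>v p) \<in> ?P \<rightarrow> carrier_vec n" using p by auto
    have fs: "finsum_vec TYPE(int) n (\<lambda>p. int (k p) \<cdot>\<^sub>v p) ?P \<in> carrier_vec n"
      by (rule finsum_vec_closed[OF carr])
    then show "dim_vec (?c + finsum_vec TYPE(int) n (\<lambda>p. int (k p) \<cdot>\<^sub>v p) ?P) =
        dim_vec (int_vec n (\<Phi> (\<lambda>i. if i < s then k (p i) else 0)))"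
      by (simp add: int_vec_def)
    fix v assume "v < dim_vec (int_vec n (\<Phi> (\<lambda>i. if i < s then k (p i) else 0)))"
    then have v: "v < n" by (simp add: int_vec_def)
    have "finsum_vec TYPE(int) n (\<lambda>p. int (k p) \<cdot>\<^sub>v p) ?P $ v = (\<Sum>x\<in>?P. (int (k x) \<cdot>\<^sub>v x) $ v)"
      by (rule index_finsum_vec[OF _ v carr]) simp
    also have "\<dots> = (\<Sum>i<s. (int (k (p i)) \<cdot>\<^sub>v p i) $ v)"
      by (simp add: sum.reindex[OF inj])
    also have "\<dots> = (\<Sum>i<s. int (a v i * k (p i)))"
      using v by (simp add: p_def mult.commute)
    finally have "finsum_vec TYPE(int) n (\<lambda>p. int (k p) \<cdot>\<^sub>v p) ?P $ v = (\<Sum>i<s. int (a v i * k (p i)))" .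
    moreover have "(\<lambda>i. if i < s then k (p i) else 0) \<in> Nvec s" by (simp add: Nvec_def)
    ultimately show "(?c + finsum_vec TYPE(int) n (\<lambda>p. int (k p) \<cdot>\<^sub>v p) ?P) $ v =
        int_vec n (\<Phi> (\<lambda>i. if i < s then k (p i) else 0)) $ v"
      using v fs \<Phi>_eq by (simp add: int_vec_def)
  qed
  have "int_vec n ` C = {?c + finsum_vec TYPE(int) n (\<lambda>p. int (k p) \<cdot>\<^sub>v p) ?P | k :: int vec \<Rightarrow> nat. True}"
    (is "_ = ?R")
  proof (intro equalityI subsetI)
    fix x assume "x \<in> int_vec n ` C"
    then obtain k where k: "k \<in> Nvec s" "x = int_vec n (\<Phi> k)" unfolding C by blast
    \<comment> \<open>Coefficients in a fundamental lattice are attached to the periods themselves,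
      so those indexed by numbers are carried over along the inverse of \<open>p\<close>.\<close>
    let ?k = "\<lambda>q. k (the_inv_into {..<s} p q)"
    have "(\<lambda>i. if i < s then ?k (p i) else 0) = k"
      using k(1) by (auto simp: the_inv_into_f_f[OF inj] Nvec_def)
    then show "x \<in> ?R" using comb[of ?k] k(2) by (intro CollectI exI[of _ ?k]) simp
  next
    fix x assume "x \<in> ?R"
    then obtain k where "x = int_vec n (\<Phi> (\<lambda>i. if i < s then k (p i) else 0))"
      unfolding comb by blast
    then show "x \<in> int_vec n ` C" unfolding C by (auto simp: Nvec_def)
  qed
  moreover have "finite ?P" "?P \<subseteq> carrier_vec n" "?c \<in> carrier_vec n" using p by auto
  ultimately show ?thesis unfolding fundamental_lattice_def using indpt by blast
qed

section \<open>Expansion of polynomial functions into monomials\<close>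

definition exponents :: "nat \<Rightarrow> nat \<Rightarrow> nat vec set" where
  "exponents n d = {\<alpha>. \<alpha> \<in> carrier_vec n \<and> (\<Sum>i<n. \<alpha> $ i) \<le> d}"

definition monomial :: "nat \<Rightarrow> nat vec \<Rightarrow> env \<Rightarrow> rat" where
  "monomial n \<alpha> e = (\<Prod>i<n. of_nat (e i) ^ (\<alpha> $ i))"

lemma finite_exponents_set [simp]: "finite (exponents n d)"
  unfolding exponents_def by (rule finite_exponents)

lemma monomial_add:
  assumes "\<alpha> \<in> carrier_vec n" "\<beta> \<in> carrier_vec n"
  shows "monomial n (\<alpha> + \<beta>) e = monomial n \<alpha> e * monomial n \<beta> e"
  using assms by (simp add: monomial_def power_add prod.distrib)

lemma sum_single_monomial:
  assumes "\<beta> \<in> exponents n d"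
  shows "(\<Sum>\<alpha>\<in>exponents n d. (if \<alpha> = \<beta> then c else 0) * monomial n \<alpha> e) = c * monomial n \<beta> e"
proof -
  have "(\<Sum>\<alpha>\<in>exponents n d. (if \<alpha> = \<beta> then c else 0) * monomial n \<alpha> e) =
      (\<Sum>\<alpha>\<in>exponents n d. if \<alpha> = \<beta> then c * monomial n \<alpha> e else 0)"
    by (rule sum.cong) auto
  then show ?thesis using assms by simp
qed

lemma polyfun_monomials:
  assumes "polyfun d p"
  shows "\<exists>a. \<forall>e\<in>Nvec n. p e = (\<Sum>\<alpha>\<in>exponents n d. a \<alpha> * monomial n \<alpha> e)"
  using assms
proof (induction rule: polyfun.induct)
  case (const d c)
  have "0\<^sub>v n \<in> exponents n d" by (simp add: exponents_def)
  moreover have "monomial n (0\<^sub>v n) e = 1" for e by (simp add: monomial_def)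
  ultimately show ?case
    by (intro exI[of _ "\<lambda>\<alpha>. if \<alpha> = 0\<^sub>v n then c else 0"]) (simp add: sum_single_monomial)
next
  case (var d i)
  show ?case
  proof (cases "i < n")
    case True
    have "(\<Sum>j<n. unit_vec n i $ j) = (\<Sum>j<n. if j = i then 1 else 0 :: nat)"
      by (rule sum.cong) (use True in auto)
    then have "unit_vec n i \<in> exponents n (Suc d)" using True by (simp add: exponents_def)
    moreover have "monomial n (unit_vec n i) e = of_nat (e i)" for e
    proof -
      have "monomial n (unit_vec n i) e = (\<Prod>j<n. if j = i then of_nat (e j) else 1)"
        unfolding monomial_def by (rule prod.cong) (use True in auto)
      then show ?thesis using True by simp
    qed
    ultimately show ?thesis
      by (intro exI[of _ "\<lambda>\<alpha>. if \<alpha> = unit_vec n i then 1 else 0"]) (simp add: sum_single_monomial)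
  next
    case False
    then show ?thesis by (intro exI[of _ "\<lambda>_. 0"]) (simp add: Nvec_def)
  qed
next
  case (add d f g)
  then obtain a b where "\<forall>e\<in>Nvec n. f e = (\<Sum>\<alpha>\<in>exponents n d. a \<alpha> * monomial n \<alpha> e)"
    "\<forall>e\<in>Nvec n. g e = (\<Sum>\<alpha>\<in>exponents n d. b \<alpha> * monomial n \<alpha> e)" by blast
  then show ?case
    by (intro exI[of _ "\<lambda>\<alpha>. a \<alpha> + b \<alpha>"]) (simp add: distrib_right sum.distrib)
next
  case (mult d f d' g)
  then obtain a b where f: "\<forall>e\<in>Nvec n. f e = (\<Sum>\<alpha>\<in>exponents n d. a \<alpha> * monomial n \<alpha> e)"
    and g: "\<forall>e\<in>Nvec n. g e = (\<Sum>\<alpha>\<in>exponents n d'. b \<alpha> * monomial n \<alpha> e)" by blast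
  let ?S = "exponents n d \<times> exponents n d'"
  \<comment> \<open>Coefficients of the Cauchy product: pairs of exponents are grouped by their
    sum.\<close>
  define h where "h \<gamma> = (\<Sum>(\<alpha>, \<beta>) | (\<alpha>, \<beta>) \<in> ?S \<and> \<alpha> + \<beta> = \<gamma>. a \<alpha> * b \<beta>)" for \<gamma>
  have "f e * g e = (\<Sum>\<gamma>\<in>exponents n (d + d'). h \<gamma> * monomial n \<gamma> e)" if e: "e \<in> Nvec n" for e
  proof -
    let ?t = "\<lambda>x. a (fst x) * b (snd x) * monomial n (fst x + snd x) e"
    have "f e * g e = (\<Sum>x\<in>?S. ?t x)"
      using f g e by (auto simp: sum_product sum.cartesian_product monomial_add exponents_def
          intro!: sum.cong)
    also have "\<dots> = (\<Sum>\<gamma>\<in>exponents n (d + d'). \<Sum>x | x \<in> ?S \<and> fst x + snd x = \<gamma>. ?t x)"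
    proof (rule sum.group[symmetric])
      show "(\<lambda>x. fst x + snd x) ` ?S \<subseteq> exponents n (d + d')"
        by (auto simp: exponents_def sum.distrib intro: add_mono)
    qed simp_all
    also have "\<dots> = (\<Sum>\<gamma>\<in>exponents n (d + d'). h \<gamma> * monomial n \<gamma> e)"
      by (auto simp: h_def sum_distrib_right case_prod_beta intro!: sum.cong)
    finally show ?thesis .
  qed
  then show ?case by blast
qed

section \<open>Evaluation of formulas and counting of predecessors\<close>

lemma tm_val_cong: "(\<And>i. i \<in> tm_vars t \<Longrightarrow> e i = e' i) \<Longrightarrow> tm_val e t = tm_val e' t"
  by (induction t) auto

lemma sat_cong: "(\<And>i. i \<in> free_vars \<phi> \<Longrightarrow> e i = e' i) \<Longrightarrow> sat e \<phi> \<longleftrightarrow> sat e' \<phi>"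
proof (induction \<phi> arbitrary: e e')
  case (Eq s t)
  then show ?case using tm_val_cong[of s e e'] tm_val_cong[of t e e'] by simp
next
  case (Neg \<phi>)
  then show ?case by (metis sat.simps(2) free_vars.simps(2))
next
  case (Conj \<phi> \<psi>)
  then show ?case by (metis sat.simps(3) free_vars.simps(3) UnCI)
next
  case (Exi \<phi>)
  have "sat (case_nat y e) \<phi> \<longleftrightarrow> sat (case_nat y e') \<phi>" for y
  proof (rule Exi.IH)
    fix i assume "i \<in> free_vars \<phi>"
    then show "case_nat y e i = case_nat y e' i" using Exi.prems by (cases i) auto
  qed
  then show ?case by simp
qed

lemma foldr_case_nat: "foldr case_nat ys e i = (if i < length ys then ys ! i else e (i - length ys))"
proof (induction ys arbitrary: i)
  case (Cons y ys)
  then show ?case by (cases i) auto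
qed simp

lemma order_iso_card:
  assumes R: "R \<subseteq> carrier_vec n \<times> carrier_vec n" and f: "order_iso_nat n R f" and x: "x \<in> carrier_vec n"
  shows "finite {y. (y, x) \<in> R}" "card {y. (y, x) \<in> R} = f x"
proof -
  have bij: "bij_betw f (carrier_vec n) UNIV"
    and iff: "\<And>y. y \<in> carrier_vec n \<Longrightarrow> (y, x) \<in> R \<longleftrightarrow> f y < f x"
    using f x by (auto simp: order_iso_nat_def)
  have "bij_betw f {y. (y, x) \<in> R} {..<f x}"
  proof (rule bij_betw_subset[OF bij])
    show "f ` {y. (y, x) \<in> R} = {..<f x}"
    proof (intro equalityI subsetI)
      fix k assume k: "k \<in> {..<f x}"
      obtain y where "y \<in> carrier_vec n" "f y = k"
        using bij by (metis UNIV_I bij_betw_imp_surj_on imageE)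
      then show "k \<in> f ` {y. (y, x) \<in> R}" using iff k by auto
    next
      fix k assume "k \<in> f ` {y. (y, x) \<in> R}"
      then show "k \<in> {..<f x}" using iff R by auto
    qed
    show "{y. (y, x) \<in> R} \<subseteq> carrier_vec n" using R by auto
  qed
  then show "finite {y. (y, x) \<in> R}" "card {y. (y, x) \<in> R} = f x"
    using bij_betw_finite bij_betw_same_card by fastforce+
qed

theorem theorem15:
  fixes n :: nat and R :: "nat vec rel" and f :: "nat vec \<Rightarrow> nat"
  assumes "definable_rel n R"
    and "strict_linear_order_on (carrier_vec n) R"
    and "order_iso_nat n R f"
  shows "piecewise_polynomial n n f"
proof -
  have R: "R \<subseteq> carrier_vec n \<times> carrier_vec n"
    using assms(1) by (simp add: definable_rel_def)
  obtain \<phi> where \<phi>: "free_vars \<phi> \<subseteq> {..<n + n}"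
    and sat: "\<And>z. z \<in> carrier_vec (n + n) \<Longrightarrow>
      z \<in> (\<lambda>(x, y). x @\<^sub>v y) ` R \<longleftrightarrow> sat (\<lambda>i. z $ i) \<phi>"
    using assms(1) unfolding definable_rel_def definable_def by blast
  have R_iff: "(y, x) \<in> R \<longleftrightarrow> sat (\<lambda>i. (y @\<^sub>v x) $ i) \<phi>"
    if "y \<in> carrier_vec n" "x \<in> carrier_vec n" for x y
  proof -
    have "y @\<^sub>v x \<in> (\<lambda>(x, y). x @\<^sub>v y) ` R \<longleftrightarrow> (y, x) \<in> R"
      using that R by (auto simp: image_iff Bex_def)
    then show ?thesis using sat[of "y @\<^sub>v x"] that by simp
  qed
  \<comment> \<open>The list holds the coordinates of a predecessor, and \<open>e\<close> begins
    with those of the point itself, in the order in which the formula reads the pair.\<close>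
  let ?S = "\<lambda>e. {ys. length ys = n \<and> sat (foldr case_nat ys e) \<phi>}"
  have S: "bij_betw vec_of_list (?S e) {y. (y, vec n e) \<in> R}" for e
  proof -
    have iff: "sat (foldr case_nat ys e) \<phi> \<longleftrightarrow> (vec_of_list ys, vec n e) \<in> R" if "length ys = n" for ys
    proof -
      \<comment> \<open>The two assignments need to agree only below n + n, which is the bound on
        the free variables; beyond it the vector has no specified entries.\<close>
      have "sat (foldr case_nat ys e) \<phi> \<longleftrightarrow> sat (\<lambda>i. (vec_of_list ys @\<^sub>v vec n e) $ i) \<phi>"
      proof (rule sat_cong)
        fix i assume "i \<in> free_vars \<phi>"
        then have "i < n + n" using \<phi> by blast
        then show "foldr case_nat ys e i = (vec_of_list ys @\<^sub>v vec n e) $ i"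
          by (simp add: foldr_case_nat vec_of_list_index that)
      qed
      then show ?thesis using R_iff[of "vec_of_list ys" "vec n e"] that
        by (simp add: carrier_vecI)
    qed
    show ?thesis
    proof (rule bij_betwI[where g = list_of_vec])
      show "vec_of_list \<in> ?S e \<rightarrow> {y. (y, vec n e) \<in> R}" using iff by blast
      show "list_of_vec \<in> {y. (y, vec n e) \<in> R} \<rightarrow> ?S e"
      proof
        fix y assume y: "y \<in> {y. (y, vec n e) \<in> R}"
        then have "dim_vec y = n" using R by auto
        then show "list_of_vec y \<in> ?S e" using y iff[of "list_of_vec y"] by (simp add: vec_list)
      qed
    qed (simp_all add: list_vec vec_list)
  qed
  \<comment> \<open>Only the first n entries of \<open>e\<close> matter, so finiteness holds at
    every environment and not just on \<open>Nvec n\<close>, as the count requires.\<close>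
  have fin: "finite (?S e)" and card: "card (?S e) = f (vec n e)" for e
    using order_iso_card[OF R assms(3), of "vec n e"] bij_betw_finite[OF S[of e]]
      bij_betw_same_card[OF S[of e]] by simp_all
  have "pwpoly n (\<lambda>e. of_nat (f (vec n e)))"
    using pwpoly_card[OF presb_sat fin] by (simp only: card)
  then obtain P where P: "finite P" "\<forall>A\<in>P. presb A"
    and poly: "\<And>V. \<exists>p. polyfun n p \<and> (\<forall>e. cell P V e \<longrightarrow> of_nat (f (vec n e)) = p e)"
    using pwpoly_pieces by meson
  have "\<forall>V. \<exists>\<C>. finite \<C> \<and> disjoint \<C> \<and> (\<forall>C\<in>\<C>. affine_lattice n C) \<and> \<Union>\<C> = {e \<in> Nvec n. cell P V e}"
    using lattice_union_presb[OF presb_cell[OF P]] unfolding lattice_union_def by blast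
  then obtain \<C> where \<C>: "\<And>V. finite (\<C> V)" "\<And>V. disjoint (\<C> V)"
    "\<And>V C. C \<in> \<C> V \<Longrightarrow> affine_lattice n C" "\<And>V. \<Union>(\<C> V) = {e \<in> Nvec n. cell P V e}"
    by metis
  \<comment> \<open>Patterns are restricted to subsets of \<open>P\<close>: there are finitely many
    of them, and every environment lies in exactly one of their cells.\<close>
  define \<D> where "\<D> = (\<Union>V\<in>Pow P. \<C> V)"
  \<comment> \<open>A partition has no empty block; a lattice contains the image of the zero
    parameter.\<close>
  have nonempty: "C \<noteq> {}" if "C \<in> \<D>" for C
  proof -
    have "(\<lambda>_. 0) \<in> Nvec s" for s by (simp add: Nvec_def)
    then show ?thesis using that \<C>(3) unfolding \<D>_def affine_lattice_def by blast
  qed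
  have part: "partition_on (Nvec n) \<D>"
  proof (rule partition_onI)
    show "\<Union>\<D> = Nvec n"
    proof -
      have "\<Union>\<D> = (\<Union>V\<in>Pow P. {e \<in> Nvec n. cell P V e})" unfolding \<D>_def \<C>(4)[symmetric] by blast
      also have "\<dots> = Nvec n"
      proof (intro equalityI subsetI)
        fix e assume e: "e \<in> Nvec n"
        obtain V where "V \<in> Pow P" "cell P V e" using ex1_cell[of P e] by auto
        then show "e \<in> (\<Union>V\<in>Pow P. {e \<in> Nvec n. cell P V e})" using e by (intro UN_I[of V]) simp_all
      qed auto
      finally show ?thesis .
    qed
    fix C D assume CD: "C \<in> \<D>" "D \<in> \<D>" "C \<noteq> D"
    then obtain V W where VW: "V \<in> Pow P" "C \<in> \<C> V" "W \<in> Pow P" "D \<in> \<C> W" unfolding \<D>_def by blast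
    show "disjnt C D"
    proof (cases "V = W")
      case True
      then show ?thesis using \<C>(2)[of W] VW CD(3) by (auto simp: disjoint_def disjnt_def)
    next
      case False
      have "cell P V e" if "e \<in> C" for e using \<C>(4)[of V] VW(2) that by blast
      moreover have "cell P W e" if "e \<in> D" for e using \<C>(4)[of W] VW(4) that by blast
      moreover have "\<not> (cell P V e \<and> cell P W e)" for e
        using ex1_cell[of P e] VW(1,3) False by auto
      ultimately show ?thesis unfolding disjnt_iff by blast
    qed
  next
    show "{} \<notin> \<D>" using nonempty by blast
  qed
  let ?\<E> = "(`) (int_vec n) ` \<D>"
  have "partition_on (map_vec int ` carrier_vec n) ?\<E>"
  proof -
    have "{} \<notin> ?\<E>" using nonempty by auto
    then show ?thesis
      using partition_on_inj_image[OF part inj_on_int_vec] by (simp add: int_vec_image)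
  qed
  moreover have "finite ?\<E>" using P \<C>(1) by (simp add: \<D>_def)
  moreover have "fundamental_lattice n E \<and>
      polynomial_on n n {x \<in> carrier_vec n. map_vec int x \<in> E} f" if "E \<in> ?\<E>" for E
  proof -
    obtain V C where C: "C \<in> \<C> V" "E = int_vec n ` C" using \<open>E \<in> ?\<E>\<close> unfolding \<D>_def by blast
    obtain p where p: "polyfun n p" "\<And>e. cell P V e \<Longrightarrow> of_nat (f (vec n e)) = p e"
      using poly[of V] by blast
    obtain a where a: "\<And>e. e \<in> Nvec n \<Longrightarrow> p e = (\<Sum>\<alpha>\<in>exponents n n. a \<alpha> * monomial n \<alpha> e)"
      using polyfun_monomials[OF p(1)] by blast
    have "of_nat (f x) = (\<Sum>\<alpha>\<in>exponents n n. a \<alpha> * (\<Prod>i<n. of_nat (x $ i) ^ (\<alpha> $ i)))"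
      if x: "x \<in> carrier_vec n" "map_vec int x \<in> E" for x
    proof -
      obtain e where e: "e \<in> C" "map_vec int x = int_vec n e" using x(2) C(2) by blast
      have e': "e \<in> Nvec n" "cell P V e" using \<C>(4)[of V] C(1) e(1) by blast+
      have x_eq: "x = vec n e"
        using e(2) x(1) by (auto simp: int_vec_def vec_eq_iff)
      have "monomial n \<alpha> e = (\<Prod>i<n. of_nat (x $ i) ^ (\<alpha> $ i))" for \<alpha>
        unfolding monomial_def by (rule prod.cong) (simp_all add: x_eq)
      then show ?thesis
        using p(2)[OF e'(2)] a[OF e'(1)] by (simp only: x_eq)
    qed
    then have "polynomial_on n n {x \<in> carrier_vec n. map_vec int x \<in> E} f"
      unfolding polynomial_on_def exponents_def by (intro exI[of _ a]) blast
    then show ?thesis using fundamental_lattice_int_vec[OF \<C>(3)[OF C(1)]] C(2) by simp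
  qed
  ultimately show ?thesis unfolding piecewise_polynomial_def by blast
qed

end
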